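(* Let $P\in\mathcal P(\mathcal X)$, $E\ge 0$ and $0\le \Delta\le \Delta_{\max}:=\min_{y\in\mathcal Y}\sum_{x\in\mathcal X}P(x)d(x,y)$. Then $$R_{\rm M}(E\mid\Delta,P)=\sup_{\nu\ge 0}\ \inf_{\mu\ge 0}\Big[-\nu\Delta+\mu E+\min_{p_Y\in\mathcal P(\mathcal Y)}G^{(\mu,\nu)}(p_Y\mid P)\Big].$$
   Context: $\mathcal X,\mathcal Y$ are finite nonempty sets; $\mathcal P(\mathcal X)$ denotes the set of probability distributions on $\mathcal X$ (similarly $\mathcal P(\mathcal Y)$), and $\mathcal P(\mathcal Y|\mathcal X)$ the set of conditional distributions of $\mathcal Y$ given $\mathcal X$. A distortion measure $d:\mathcal X\times\mathcal Y\to[0,\infty)$ is given with $\max_{x}\min_{y}d(x,y)=0$. Logarithms are natural. For $q\in\mathcal P(\mathcal X)$ and $\Delta\ge0$ the rate-distortion function is $R(\Delta\mid q)=\min\{I(q,V):V\in\mathcal P(\mathcal Y|\mathcal X),\ \sum_{x,y}q(x)V(y|x)d(x,y)\le\Delta\}$, where $I(q,V)$ is the mutual information. $D(q\|P)$ is the relative entropy. The inverse Marton function is $R_{\rm M}(E\mid\Delta,P)=\max\{R(\Delta\mid q_X): q_X\in\mathcal P(\mathcal X),\ D(q_X\|P)\le E\}$. For $\mu,\nu\ge0$, $p_Y\in\mathcal P(\mathcal Y)$: $G^{(\mu,\nu)}(p_Y\mid P)=\mu\log\sum_x P(x)\big(\sum_y p_Y(y)e^{-\nu d(x,y)}\big)^{-1/\mu}$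 if $\mu>0$, and $G^{(0,\nu)}(p_Y\mid P)=-\log\min_{x\in\mathcal X}\sum_y p_Y(y)e^{-\nu d(x,y)}$. *)

theory Defs
  imports "HOL-Analysis.Analysis" "HOL-Library.Extended_Real"
begin

definition is_dist :: "('a::finite \<Rightarrow> real) \<Rightarrow> bool" where
  "is_dist p \<longleftrightarrow> (\<forall>a. 0 \<le> p a) \<and> (\<Sum>a\<in>UNIV. p a) = 1"

definition is_cond_dist :: "('a::finite \<Rightarrow> 'b::finite \<Rightarrow> real) \<Rightarrow> bool" where
  "is_cond_dist V \<longleftrightarrow> (\<forall>x. is_dist (V x))"

definition out_dist :: "('a::finite \<Rightarrow> real) \<Rightarrow> ('a \<Rightarrow> 'b::finite \<Rightarrow> real) \<Rightarrow> 'b \<Rightarrow> real" where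
  "out_dist q V y = (\<Sum>x\<in>UNIV. q x * V x y)"

definition mutual_info :: "('a::finite \<Rightarrow> real) \<Rightarrow> ('a \<Rightarrow> 'b::finite \<Rightarrow> real) \<Rightarrow> real" where
  "mutual_info q V = (\<Sum>x\<in>UNIV. \<Sum>y\<in>UNIV.
      (if q x * V x y = 0 then 0 else q x * V x y * ln (V x y / out_dist q V y)))"

definition rel_ent :: "('a::finite \<Rightarrow> real) \<Rightarrow> ('a \<Rightarrow> real) \<Rightarrow> ereal" where
  "rel_ent q P = (if \<exists>x. q x > 0 \<and> P x = 0 then \<infinity>
     else ereal (\<Sum>x\<in>UNIV. if q x = 0 then 0 else q x * ln (q x / P x)))"

text \<open>Rate-distortion function R(Delta | q) (a minimum, written as an infimum).\<close>
definition rate_dist :: "('a::finite \<Rightarrow> 'b::finite \<Rightarrow> real) \<Rightarrow> real \<Rightarrow> ('a \<Rightarrow> real) \<Rightarrow> real" where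
  "rate_dist d \<Delta> q = Inf {mutual_info q V | V. is_cond_dist V \<and>
       (\<Sum>x\<in>UNIV. \<Sum>y\<in>UNIV. q x * V x y * d x y) \<le> \<Delta>}"

text \<open>Inverse Marton function R_M(E | Delta, P) (a maximum, written as a supremum).\<close>
definition marton_inv :: "('a::finite \<Rightarrow> 'b::finite \<Rightarrow> real) \<Rightarrow> real \<Rightarrow> real \<Rightarrow> ('a \<Rightarrow> real) \<Rightarrow> real" where
  "marton_inv d E \<Delta> P = Sup {rate_dist d \<Delta> q | q. is_dist q \<and> rel_ent q P \<le> ereal E}"

definition G_fun :: "('a::finite \<Rightarrow> 'b::finite \<Rightarrow> real) \<Rightarrow> real \<Rightarrow> real \<Rightarrow> ('b \<Rightarrow> real) \<Rightarrow> ('a \<Rightarrow> real) \<Rightarrow> real" where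
  "G_fun d \<mu> \<nu> pY P = (if \<mu> > 0
     then \<mu> * ln (\<Sum>x\<in>UNIV. P x * (\<Sum>y\<in>UNIV. pY y * exp (- \<nu> * d x y)) powr (- 1 / \<mu>))
     else - ln (Min (range (\<lambda>x. \<Sum>y\<in>UNIV. pY y * exp (- \<nu> * d x y)))))"

text \<open>min over p_Y of G^(mu,nu)(p_Y | P), written as an infimum.\<close>
definition G_min :: "('a::finite \<Rightarrow> 'b::finite \<Rightarrow> real) \<Rightarrow> real \<Rightarrow> real \<Rightarrow> ('a \<Rightarrow> real) \<Rightarrow> real" where
  "G_min d \<mu> \<nu> P = Inf {G_fun d \<mu> \<nu> pY P | pY. is_dist pY}"

end

theory Submission
  imports Defs
begin

text \<open>
  For \<open>\<nu> \<ge> 0\<close> and an output distribution \<open>p\<close> put \<open>f x = - ln (\<Sum>y. p y * exp (- \<nu> * d x y))\<close>.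
  Lagrange duality in the distortion constraint and the variational formula for mutual information
  give \<open>R(\<Delta> | q) = sup\<^sub>\<nu> inf\<^sub>p (- \<nu> * \<Delta> + \<Sum>x. q x * f x)\<close>. For fixed \<open>\<nu>\<close> the bracket is linear in
  \<open>q\<close> and convex in \<open>p\<close>, so the supremum over the compact convex ball \<open>D(q || P) \<le> E\<close> may be moved
  inside the infimum over \<open>p\<close>. Lagrange duality in the relative entropy constraint, with Gibbs'
  variational principle, evaluates this inner supremum as
  \<open>inf\<^sub>\<mu> (\<mu> * E + \<mu> * ln (\<Sum>x. P x * exp (f x / \<mu>)))\<close>, which is the expression with \<open>G\<close>.
  \<open>R(\<Delta> | q)\<close> itself need not be quasiconcave in \<open>q\<close>, so the supremum over \<open>\<nu>\<close> has to stay outermost.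
  All three exchanges are instances of Ky Fan's minimax theorem, in which only one side is compact;
  this covers the degenerate cases \<open>E = 0\<close> and \<open>\<Delta> = 0\<close>, where an optimal multiplier may fail to exist.
\<close>

section \<open>Ky Fan's minimax theorem\<close>

text \<open>Convexity in the sense of Ky Fan: the interpolating point need not be a convex combination,
  so distributions can stay plain functions, a type without a vector space instance.\<close>

definition convexlike_on :: "'a set \<Rightarrow> 'b set \<Rightarrow> ('a \<Rightarrow> 'b \<Rightarrow> real) \<Rightarrow> bool" where
  "convexlike_on A B f \<longleftrightarrow> (\<forall>x1\<in>A. \<forall>x2\<in>A. \<forall>t\<in>{0..1}. \<exists>x\<in>A. \<forall>y\<in>B.
     f x y \<le> t * f x1 y + (1 - t) * f x2 y)"

lemma convexlike_onI:
  assumes "\<And>x1 x2 t. x1 \<in> A \<Longrightarrow> x2 \<in> A \<Longrightarrow> 0 \<le> t \<Longrightarrow> t \<le> 1 \<Longrightarrow> g x1 x2 t \<in> A"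
    and "\<And>x1 x2 t y. x1 \<in> A \<Longrightarrow> x2 \<in> A \<Longrightarrow> 0 \<le> t \<Longrightarrow> t \<le> 1 \<Longrightarrow> y \<in> B \<Longrightarrow>
      f (g x1 x2 t) y \<le> t * f x1 y + (1 - t) * f x2 y"
  shows "convexlike_on A B f"
  unfolding convexlike_on_def
  by (intro ballI) (rule_tac x="g x1 x2 t" in bexI, use assms in auto)

lemma convexlike_on_subset: "convexlike_on A B f \<Longrightarrow> B' \<subseteq> B \<Longrightarrow> convexlike_on A B' f"
  unfolding convexlike_on_def by (meson subsetD)

lemma compact_sublevel:
  fixes f :: "'a::topological_space \<Rightarrow> real"
  assumes "compact K" "continuous_on K f"
  shows "compact {x\<in>K. f x \<le> c}"
proof -
  have "closedin (top_of_set K) (K \<inter> f -` {..c})"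
    by (rule continuous_closedin_preimage[OF assms(2)]) simp
  moreover have "K \<inter> f -` {..c} = {x\<in>K. f x \<le> c}" by auto
  ultimately show ?thesis
    using closedin_compact[OF assms(1)] by metis
qed

text \<open>Compactness makes the minimum \<open>m\<close> of \<open>max (f x) (g x)\<close>
  attained, hence strictly above \<open>c\<close>; a separating line in the plane then turns the
  pointwise alternative into a bound for one fixed mixture. The \<open>bool\<close> index packs
  \<open>f\<close> and \<open>g\<close> into one family, so that a single interpolating point serves
  both.\<close>

lemma mixture_of_two:
  fixes f g :: "'a::topological_space \<Rightarrow> real"
  assumes K: "compact K" and f: "continuous_on K f" and g: "continuous_on K g"
    and cvx: "convexlike_on K UNIV (\<lambda>x b. if b then f x else g x)"
    and gt: "\<And>x. x \<in> K \<Longrightarrow> c < f x \<or> c < g x"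
  obtains t :: real where "0 \<le> t" "t \<le> 1" "\<And>x. x \<in> K \<Longrightarrow> c < t * f x + (1 - t) * g x"
proof (cases "K = {}")
  case True
  then show ?thesis using that[of 0] by simp
next
  case False
  have "continuous_on K (\<lambda>x. max (f x) (g x))" using f g by (intro continuous_intros)
  then obtain x0 where x0: "x0 \<in> K" "\<And>x. x \<in> K \<Longrightarrow> max (f x0) (g x0) \<le> max (f x) (g x)"
    using continuous_attains_inf[OF K False] by blast
  define m where "m = max (f x0) (g x0)"
  have "c < m" using gt[OF x0(1)] by (auto simp: m_def)
  \<comment> \<open>The normal of a line separating the epigraph S of the pair from the open quadrant T below its
    minimax value m has nonnegative coordinates; normalised, they are the weights.\<close>
  define S where "S = {p :: real \<times> real. \<exists>x\<in>K. f x \<le> fst p \<and> g x \<le> snd p}"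
  define T where "T = {..<m} \<times> {..<m}"
  have "convex S"
  proof (rule convexI)
    fix p q and u v :: real
    assume p: "p \<in> S" and q: "q \<in> S" and uv: "0 \<le> u" "0 \<le> v" "u + v = 1"
    obtain x1 x2 where x12: "x1 \<in> K" "f x1 \<le> fst p" "g x1 \<le> snd p" "x2 \<in> K" "f x2 \<le> fst q" "g x2 \<le> snd q"
      using p q unfolding S_def by blast
    have v: "v = 1 - u" and u: "u \<in> {0..1}" using uv by auto
    obtain x where x: "x \<in> K" "\<forall>b\<in>UNIV. (if b then f x else g x) \<le>
        u * (if b then f x1 else g x1) + (1 - u) * (if b then f x2 else g x2)"
      using cvx x12 u unfolding convexlike_on_def by blast
    have "f x \<le> u * f x1 + v * f x2" "g x \<le> u * g x1 + v * g x2"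
      using bspec[OF x(2), of True] bspec[OF x(2), of False] v by simp_all
    moreover have "u * f x1 + v * f x2 \<le> u * fst p + v * fst q" "u * g x1 + v * g x2 \<le> u * snd p + v * snd q"
      using x12 uv by (auto intro!: add_mono mult_left_mono)
    ultimately show "u *\<^sub>R p + v *\<^sub>R q \<in> S"
      using x(1) unfolding S_def by force
  qed
  moreover have "convex T" unfolding T_def by (intro convex_Times) simp_all
  moreover have "(f x0, g x0) \<in> S" using x0 by (auto simp: S_def)
  moreover have "(m - 1, m - 1) \<in> T" by (simp add: T_def)
  moreover have "S \<inter> T = {}"
    using x0 by (fastforce simp: S_def T_def m_def)
  ultimately obtain a b where a: "a \<noteq> 0" "\<And>x. x \<in> T \<Longrightarrow> a \<bullet> x \<le> b" "\<And>x. x \<in> S \<Longrightarrow> b \<le> a \<bullet> x"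
    using separating_hyperplane_sets[of T S] by (metis Int_commute empty_iff)
  obtain \<alpha> \<beta> where ab: "a = (\<alpha>, \<beta>)" by fastforce
  have T: "\<alpha> * u + \<beta> * v \<le> b" if "u < m" "v < m" for u v
    using a(2)[of "(u, v)"] that by (simp add: T_def ab)
  have S: "b \<le> \<alpha> * u + \<beta> * v" if "x \<in> K" "f x \<le> u" "g x \<le> v" for x u v
    using a(3)[of "(u, v)"] that by (auto simp: S_def ab)
  have nn: "0 \<le> \<alpha>"
  proof (rule ccontr)
    assume "\<not> 0 \<le> \<alpha>"
    then have "\<alpha> < 0" by simp
    \<comment> \<open>\<open>S\<close> is closed upwards. At this first coordinate, paired with
      \<open>g x0\<close>, the separating functional would be at most \<open>b - 1\<close> on a
      point of \<open>S\<close>.\<close>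
    let ?u = "max (f x0) ((b - \<beta> * g x0 - 1) / \<alpha>)"
    have "\<alpha> * ?u \<le> \<alpha> * ((b - \<beta> * g x0 - 1) / \<alpha>)"
      using \<open>\<alpha> < 0\<close> by (intro mult_left_mono_neg) auto
    then show False using S[OF x0(1), of ?u "g x0"] \<open>\<alpha> < 0\<close> by simp
  qed
  have nn': "0 \<le> \<beta>"
  proof (rule ccontr)
    assume "\<not> 0 \<le> \<beta>"
    then have "\<beta> < 0" by simp
    let ?u = "max (g x0) ((b - \<alpha> * f x0 - 1) / \<beta>)"
    have "\<beta> * ?u \<le> \<beta> * ((b - \<alpha> * f x0 - 1) / \<beta>)"
      using \<open>\<beta> < 0\<close> by (intro mult_left_mono_neg) auto
    then show False using S[OF x0(1), of "f x0" ?u] \<open>\<beta> < 0\<close> by simp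
  qed
  have pos: "0 < \<alpha> + \<beta>" using nn nn' a(1) ab by (auto simp: zero_prod_def)
  have "(\<alpha> + \<beta>) * m \<le> b"
  \<comment> \<open>\<open>T\<close> is open and omits its corner \<open>(m, m)\<close>. Going
    \<open>e / (\<alpha> + \<beta>)\<close> below the corner in both coordinates lowers the
    functional by exactly \<open>e\<close>.\<close>
  proof (rule field_le_epsilon)
    fix e :: real assume "0 < e"
    have "\<alpha> * (m - e / (\<alpha> + \<beta>)) + \<beta> * (m - e / (\<alpha> + \<beta>)) \<le> b"
      using pos \<open>0 < e\<close> by (intro T) auto
    moreover have "\<alpha> * (m - e / (\<alpha> + \<beta>)) + \<beta> * (m - e / (\<alpha> + \<beta>)) = (\<alpha> + \<beta>) * m - e"
      using pos by (simp flip: distrib_right) (simp add: right_diff_distrib)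
    ultimately show "(\<alpha> + \<beta>) * m \<le> b + e" by linarith
  qed
  define t where "t = \<alpha> / (\<alpha> + \<beta>)"
  have t': "1 - t = \<beta> / (\<alpha> + \<beta>)" using pos by (simp add: t_def field_simps)
  have "c < t * f x + (1 - t) * g x" if "x \<in> K" for x
  proof -
    have "(\<alpha> + \<beta>) * m \<le> \<alpha> * f x + \<beta> * g x"
      using S[OF that order_refl order_refl] \<open>(\<alpha> + \<beta>) * m \<le> b\<close> by linarith
    then have "m \<le> (\<alpha> * f x + \<beta> * g x) / (\<alpha> + \<beta>)"
      using pos by (simp add: pos_le_divide_eq mult.commute)
    also have "\<dots> = t * f x + (1 - t) * g x"
      unfolding t' unfolding t_def by (simp add: add_divide_distrib)
    finally show ?thesis using \<open>c < m\<close> by linarith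
  qed
  then show ?thesis using that[of t] nn nn' pos by (simp add: t_def)
qed

text \<open>Induction on \<open>A\<close> with \<open>K\<close> varying. The induction hypothesis is
  applied to the sublevel set where the new index \<open>a\<close> fails and yields
  \<open>y0\<close> there; on all of \<open>K\<close>, \<open>a\<close> and \<open>y0\<close>
  satisfy the alternative of \<open>mixture_of_two\<close>, and concavity in \<open>y\<close>
  replaces their mixture by one element of \<open>Y\<close>.\<close>

lemma finite_mixture:
  fixes f :: "'a::topological_space \<Rightarrow> 'b \<Rightarrow> real"
  assumes cont: "\<And>y. y \<in> Y \<Longrightarrow> continuous_on K (\<lambda>x. f x y)"
    and cvx: "convexlike_on K Y f"
    and ccv: "convexlike_on Y K (\<lambda>y x. - f x y)"
    and "Y \<noteq> {}" "finite A" "A \<subseteq> Y" "compact K"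
    and "\<And>x. x \<in> K \<Longrightarrow> \<exists>y\<in>A. c < f x y"
  shows "\<exists>y\<in>Y. \<forall>x\<in>K. c < f x y"
  using assms(5,6,7,8) cont cvx ccv
proof (induction A arbitrary: K rule: finite_induct)
  case empty
  then show ?case using \<open>Y \<noteq> {}\<close> by auto
next
  case (insert a A)
  note cont = insert.prems(4) and cvx = insert.prems(5) and ccv = insert.prems(6)
  define K' where "K' = {x\<in>K. f x a \<le> c}"
  have "K' \<subseteq> K" by (auto simp: K'_def)
  have a: "a \<in> Y" using insert by auto
  have "\<exists>y\<in>Y. \<forall>x\<in>K'. c < f x y"
  proof (rule insert.IH)
    show "A \<subseteq> Y" using insert by auto
    show "compact K'" unfolding K'_def using compact_sublevel insert.prems cont a by blast
    show "\<exists>y\<in>A. c < f x y" if "x \<in> K'" for x using insert.prems(3)[of x] that by (auto simp: K'_def)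
    show "continuous_on K' (\<lambda>x. f x y)" if "y \<in> Y" for y
      using cont[OF that] continuous_on_subset \<open>K' \<subseteq> K\<close> by blast
    show "convexlike_on K' Y f"
      unfolding convexlike_on_def
    proof (intro ballI)
      fix x1 x2 and t :: real assume *: "x1 \<in> K'" "x2 \<in> K'" "t \<in> {0..1}"
      then obtain x where x: "x \<in> K" "\<forall>y\<in>Y. f x y \<le> t * f x1 y + (1 - t) * f x2 y"
        using cvx \<open>K' \<subseteq> K\<close> unfolding convexlike_on_def by blast
      \<comment> \<open>The interpolating point serves all of \<open>Y\<close> at once, in
        particular \<open>a\<close>, so it does not leave the sublevel set.\<close>
      have "f x a \<le> t * f x1 a + (1 - t) * f x2 a" using x a by auto
      also have "\<dots> \<le> t * c + (1 - t) * c"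
        using * by (intro add_mono mult_left_mono) (auto simp: K'_def)
      also have "\<dots> = c" by (simp add: algebra_simps)
      finally show "\<exists>x\<in>K'. \<forall>y\<in>Y. f x y \<le> t * f x1 y + (1 - t) * f x2 y"
        using x by (auto simp: K'_def)
    qed
    show "convexlike_on Y K' (\<lambda>y x. - f x y)" using convexlike_on_subset ccv \<open>K' \<subseteq> K\<close> by blast
  qed
  then obtain y0 where y0: "y0 \<in> Y" "\<forall>x\<in>K'. c < f x y0" by blast
  have "convexlike_on K UNIV (\<lambda>x b. if b then f x a else f x y0)"
    unfolding convexlike_on_def
  proof (intro ballI)
    fix x1 x2 and t :: real assume *: "x1 \<in> K" "x2 \<in> K" "t \<in> {0..1}"
    then obtain x where "x \<in> K" "\<forall>y\<in>Y. f x y \<le> t * f x1 y + (1 - t) * f x2 y"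
      using cvx unfolding convexlike_on_def by blast
    then show "\<exists>x\<in>K. \<forall>b\<in>UNIV. (if b then f x a else f x y0) \<le>
        t * (if b then f x1 a else f x1 y0) + (1 - t) * (if b then f x2 a else f x2 y0)"
      using a y0 by (intro bexI[of _ x]) auto
  qed
  moreover have "c < f x a \<or> c < f x y0" if "x \<in> K" for x
    using y0(2) that by (cases "x \<in> K'") (auto simp: K'_def)
  ultimately obtain t where t: "0 \<le> t" "t \<le> 1" "\<And>x. x \<in> K \<Longrightarrow> c < t * f x a + (1 - t) * f x y0"
    using mixture_of_two[of K "\<lambda>x. f x a" "\<lambda>x. f x y0" c] insert.prems(2) cont a y0(1) by blast
  then obtain y where "y \<in> Y" "\<forall>x\<in>K. - f x y \<le> t * - f x a + (1 - t) * - f x y0"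
    using ccv a y0(1) unfolding convexlike_on_def by (metis atLeastAtMost_iff)
  then show ?case using t by (intro bexI[of _ y]) (force simp: algebra_simps)+
qed

text \<open>If the inequality that is not weak duality failed, some real \<open>c\<close> would lie
  strictly between both sides. The open sets given by \<open>c < f x y\<close> cover
  \<open>K\<close>; a finite subcover and \<open>finite_mixture\<close> produce one \<open>y\<close>
  with \<open>c < f x y\<close> on all of \<open>K\<close>, a contradiction. The values are extended
  reals because the supremum over \<open>Y\<close> may be infinite.\<close>

lemma fan_minimax:
  fixes f :: "'a::topological_space \<Rightarrow> 'b \<Rightarrow> real"
  assumes K: "compact K" and Y: "Y \<noteq> {}"
    and cont: "\<And>y. y \<in> Y \<Longrightarrow> continuous_on K (\<lambda>x. f x y)"
    and cvx: "convexlike_on K Y f"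
    and ccv: "convexlike_on Y K (\<lambda>y x. - f x y)"
  shows "(INF x\<in>K. SUP y\<in>Y. ereal (f x y)) = (SUP y\<in>Y. INF x\<in>K. ereal (f x y))" (is "?L = ?R")
proof (rule antisym)
  show "?R \<le> ?L" by (intro SUP_least INF_greatest) (meson INF_lower SUP_upper order_trans)
  show "?L \<le> ?R"
  proof (rule ccontr)
    assume "\<not> ?L \<le> ?R"
    then obtain c where c: "?R < ereal c" "ereal c < ?L" using ereal_dense2 by (metis not_le)
    have *: "\<exists>y\<in>Y. c < f x y" if "x \<in> K" for x
    proof -
      have "ereal c < (SUP y\<in>Y. ereal (f x y))" using c(2) that by (meson INF_lower less_le_trans)
      then show ?thesis by (auto simp: less_SUP_iff)
    qed
    have "\<exists>U. open U \<and> U \<inter> K = {x\<in>K. c < f x y}" if "y \<in> Y" for y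
    proof -
      have "{x\<in>K. c < f x y} = (\<lambda>x. f x y) -` {c<..} \<inter> K" by auto
      then show ?thesis using cont[OF that] open_greaterThan unfolding continuous_on_open_invariant by metis
    qed
    then obtain U where U: "\<And>y. y \<in> Y \<Longrightarrow> open (U y)" "\<And>y. y \<in> Y \<Longrightarrow> U y \<inter> K = {x\<in>K. c < f x y}"
      by metis
    have "K \<subseteq> (\<Union>y\<in>Y. U y)" using * U(2) by fastforce
    then obtain A where A: "A \<subseteq> Y" "finite A" "K \<subseteq> (\<Union>y\<in>A. U y)"
      using compactE_image[OF K, of Y U] U(1) by blast
    have "\<exists>y\<in>A. c < f x y" if x: "x \<in> K" for x
    proof -
      obtain y where y: "y \<in> A" "x \<in> U y" using A(3) x by blast
      then have "x \<in> {x\<in>K. c < f x y}" using U(2)[of y] A(1) x by blast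
      then show ?thesis using y(1) by blast
    qed
    then obtain y where y: "y \<in> Y" "\<forall>x\<in>K. c < f x y"
      using finite_mixture[OF cont cvx ccv Y A(2,1) K] by blast
    then have "ereal c \<le> (INF x\<in>K. ereal (f x y))" by (intro INF_greatest) (auto intro: less_imp_le)
    also have "\<dots> \<le> ?R" using y(1) by (rule SUP_upper)
    finally show False using c(1) by simp
  qed
qed

corollary fan_maximin:
  fixes f :: "'a::topological_space \<Rightarrow> 'b \<Rightarrow> real"
  assumes K: "compact K" and Y: "Y \<noteq> {}"
    and cont: "\<And>y. y \<in> Y \<Longrightarrow> continuous_on K (\<lambda>x. f x y)"
    and cvx: "convexlike_on K Y (\<lambda>x y. - f x y)"
    and ccv: "convexlike_on Y K (\<lambda>y x. f x y)"
  shows "(SUP x\<in>K. INF y\<in>Y. ereal (f x y)) = (INF y\<in>Y. SUP x\<in>K. ereal (f x y))"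
proof -
  have "(INF x\<in>K. SUP y\<in>Y. - ereal (f x y)) = (SUP y\<in>Y. INF x\<in>K. - ereal (f x y))"
    using fan_minimax[of K Y "\<lambda>x y. - f x y"] assms by (simp add: continuous_on_minus)
  then show ?thesis by (simp only: ereal_SUP_uminus_eq ereal_INF_uminus_eq ereal_uminus_eq_iff)
qed

section \<open>Finite distributions\<close>

text \<open>This is \<open>ln z \<le> z - 1\<close> at \<open>z = s * b / a\<close>. The left side
  is the linear function of \<open>(a, b)\<close> that supports the homogeneous convex function
  \<open>a * ln (a / b)\<close> along the ray \<open>a = s * b\<close>. The entropy inequalities
  below are sums of it for suitable \<open>s\<close>.\<close>

lemma mult_ln_ge_tangent:
  fixes a b s :: real
  assumes "0 \<le> a" "0 \<le> b" "b = 0 \<Longrightarrow> a = 0" "0 < s"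
  shows "a * ln s + a - s * b \<le> a * ln (a / b)"
proof (cases "a = 0")
  case True
  then show ?thesis using assms by simp
next
  case False
  then have pos: "0 < a" "0 < b" using assms by (auto simp: order_less_le)
  have "ln (s * b / a) \<le> s * b / a - 1"
    using pos assms by (intro ln_le_minus_one) simp
  moreover have "ln (s * b / a) = ln s - ln (a / b)"
    using pos assms by (simp add: ln_mult ln_div)
  ultimately have "a * (ln s - ln (a / b)) \<le> a * (s * b / a - 1)"
    using pos by (intro mult_left_mono) auto
  also have "\<dots> = s * b - a" using pos by (simp add: field_simps)
  finally show ?thesis by (simp add: algebra_simps)
qed

text \<open>The supporting linear function for \<open>s = a / b\<close> is exact at the mixture and
  lies below the function at both end points.\<close>

lemma mult_ln_divide_convex:
  fixes a1 a2 b1 b2 t :: real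
  assumes a: "0 \<le> a1" "0 \<le> a2" and b: "0 \<le> b1" "0 \<le> b2"
    and ab: "b1 = 0 \<Longrightarrow> a1 = 0" "b2 = 0 \<Longrightarrow> a2 = 0" and t: "0 \<le> t" "t \<le> 1"
  defines "a \<equiv> t * a1 + (1 - t) * a2" and "b \<equiv> t * b1 + (1 - t) * b2"
  shows "a * ln (a / b) \<le> t * (a1 * ln (a1 / b1)) + (1 - t) * (a2 * ln (a2 / b2))"
proof (cases "a = 0")
  case True
  then have "t * a1 = 0" "(1 - t) * a2 = 0"
    using a t by (auto simp: a_def add_nonneg_eq_0_iff)
  then show ?thesis using True by auto
next
  case False
  then have "0 < a" using a t by (simp add: a_def order_less_le)
  have "b \<noteq> 0"
  proof
    assume "b = 0"
    then have "t * b1 = 0" "(1 - t) * b2 = 0"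
      using b t by (auto simp: b_def add_nonneg_eq_0_iff)
    then show False using False ab by (auto simp: a_def)
  qed
  then have "0 < b" using b t by (simp add: b_def order_less_le)
  let ?s = "a / b"
  have s: "0 < ?s" using \<open>0 < a\<close> \<open>0 < b\<close> by simp
  have "a * ln ?s = a * ln ?s + a - ?s * b" using \<open>0 < b\<close> by simp
  also have "\<dots> = t * (a1 * ln ?s + a1 - ?s * b1) + (1 - t) * (a2 * ln ?s + a2 - ?s * b2)"
  proof -
    have "t * (a1 * l + a1 - s * b1) + (1 - t) * (a2 * l + a2 - s * b2) = a * l + a - s * b" for l s
      unfolding a_def b_def by (simp add: algebra_simps)
    then show ?thesis by (rule sym)
  qed
  also have "\<dots> \<le> t * (a1 * ln (a1 / b1)) + (1 - t) * (a2 * ln (a2 / b2))"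
    using a b ab t s by (intro add_mono mult_left_mono mult_ln_ge_tangent) auto
  finally show ?thesis .
qed

lemma continuous_on_mult_ln: "continuous_on {0..} (\<lambda>t::real. t * ln t)"
  unfolding continuous_on_def
proof
  fix x :: real assume "x \<in> {0..}"
  show "((\<lambda>t. t * ln t) \<longlongrightarrow> x * ln x) (at x within {0..})"
  proof (cases "x = 0")
    case True
    \<comment> \<open>Only the end point 0 needs care: replacing \<open>t\<close> by its inverse
      reduces the limit to \<open>ln t / t\<close> at infinity.\<close>
    have "((\<lambda>t::real. t * ln t) \<longlongrightarrow> 0) (at_right 0)"
      unfolding filterlim_at_right_to_top
    proof (rule Lim_transform_eventually)
      show "((\<lambda>t::real. - (ln t / t)) \<longlongrightarrow> 0) at_top"
        using tendsto_minus[OF ln_x_over_x_tendsto_0] by simp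
      show "\<forall>\<^sub>F t::real in at_top. - (ln t / t) = inverse t * ln (inverse t)"
        using eventually_gt_at_top[of 0] by eventually_elim (simp add: ln_inverse divide_inverse)
    qed
    then show ?thesis using True by (simp add: at_within_Ici_at_right)
  next
    case False
    then have "((\<lambda>t. t * ln t) \<longlongrightarrow> x * ln x) (at x)"
      by (intro tendsto_intros) auto
    then show ?thesis using tendsto_within_subset by blast
  qed
qed

lemma is_dist_nonneg: "is_dist p \<Longrightarrow> 0 \<le> p a"
  and is_dist_sum: "is_dist p \<Longrightarrow> (\<Sum>a\<in>UNIV. p a) = 1"
  by (simp_all add: is_dist_def)

lemma is_dist_le_1: "is_dist p \<Longrightarrow> p a \<le> 1"
  using member_le_sum[of a UNIV p] by (simp add: is_dist_def)

lemma is_dist_pos: "is_dist p \<Longrightarrow> \<exists>a. 0 < p a"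
  unfolding is_dist_def by (metis order_less_le sum.neutral zero_neq_one)

lemma is_dist_mix:
  assumes "is_dist p" "is_dist q" "0 \<le> t" "t \<le> 1"
  shows "is_dist (\<lambda>a. t * p a + (1 - t) * q a)"
  using assms by (simp add: is_dist_def sum.distrib flip: sum_distrib_left)

lemma is_cond_dist_mix:
  assumes "is_cond_dist V" "is_cond_dist W" "0 \<le> t" "t \<le> 1"
  shows "is_cond_dist (\<lambda>x y. t * V x y + (1 - t) * W x y)"
  using assms is_dist_mix unfolding is_cond_dist_def by blast

lemma is_dist_expectation_le:
  assumes "is_dist p" "\<And>a. f a \<le> c"
  shows "(\<Sum>a\<in>UNIV. p a * f a) \<le> c"
proof -
  have "(\<Sum>a\<in>UNIV. p a * f a) \<le> (\<Sum>a\<in>UNIV. p a * c)"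
    using assms by (intro sum_mono mult_left_mono) (auto simp: is_dist_def)
  then show ?thesis using assms by (simp add: is_dist_def flip: sum_distrib_right)
qed

lemma compact_PiE_UNIV:
  fixes S :: "'a \<Rightarrow> 'b::topological_space set"
  assumes "\<And>i. compact (S i)"
  shows "compact (PiE UNIV S)"
  using compactin_PiE[of "\<lambda>_. euclidean" UNIV S] assms
  by (simp add: euclidean_product_topology)

text \<open>Function types carry the product topology, so the simplex is a closed part of a
  Tychonoff cube.\<close>

lemma compact_dists: "compact {p. is_dist (p :: 'a::finite \<Rightarrow> real)}"
proof -
  have "continuous_on UNIV (\<lambda>p :: 'a \<Rightarrow> real. \<Sum>a\<in>UNIV. p a)"
    by (intro continuous_intros continuous_on_product_coordinates)
  then have "closed {p :: 'a \<Rightarrow> real. (\<Sum>a\<in>UNIV. p a) = 1}"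
    by (intro closed_Collect_eq) auto
  then have "compact (PiE UNIV (\<lambda>_::'a. {0..1::real}) \<inter> {p. (\<Sum>a\<in>UNIV. p a) = 1})"
    by (intro compact_Int_closed compact_PiE_UNIV) auto
  also have "PiE UNIV (\<lambda>_::'a. {0..1::real}) \<inter> {p. (\<Sum>a\<in>UNIV. p a) = 1} = {p. is_dist p}"
    by (auto simp: is_dist_le_1 is_dist_nonneg is_dist_sum PiE_def extensional_def)
      (auto simp: is_dist_def)
  finally show ?thesis .
qed

lemma compact_cond_dists: "compact {V. is_cond_dist (V :: 'a::finite \<Rightarrow> 'b::finite \<Rightarrow> real)}"
proof -
  have "{V :: 'a \<Rightarrow> 'b \<Rightarrow> real. is_cond_dist V} = PiE UNIV (\<lambda>_. {p. is_dist p})"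
    by (auto simp: is_cond_dist_def PiE_def extensional_def)
  then show ?thesis by (simp add: compact_PiE_UNIV compact_dists)
qed

lemma continuous_on_cond_coordinate:
  "continuous_on S (\<lambda>V :: 'a \<Rightarrow> 'b \<Rightarrow> 'c::topological_space. V x y)"
  by (rule continuous_on_product_then_coordinatewise
      [OF continuous_on_product_then_coordinatewise[OF continuous_on_id]])

section \<open>Relative entropy balls\<close>

text \<open>Real-valued, so that it can enter a Lagrangian. It represents \<open>rel_ent\<close>
  only for \<open>q\<close> vanishing wherever \<open>P\<close> does: elsewhere division by zero and
  \<open>ln 0 = 0\<close> turn an infinite summand into 0. Hence it is always paired with
  \<open>dists_on {x. P x \<noteq> 0}\<close>.\<close>

definition kl :: "('a::finite \<Rightarrow> real) \<Rightarrow> ('a \<Rightarrow> real) \<Rightarrow> real" where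
  "kl q P = (\<Sum>x\<in>UNIV. q x * ln (q x / P x))"

definition dists_on :: "'a::finite set \<Rightarrow> ('a \<Rightarrow> real) set" where
  "dists_on S = {q. is_dist q \<and> (\<forall>x. x \<notin> S \<longrightarrow> q x = 0)}"

lemma rel_ent_le_iff:
  assumes "is_dist q"
  shows "rel_ent q P \<le> ereal E \<longleftrightarrow> q \<in> dists_on {x. P x \<noteq> 0} \<and> kl q P \<le> E"
proof -
  have "(if q x = 0 then 0 else q x * ln (q x / P x)) = q x * ln (q x / P x)" for x by simp
  moreover have "(\<exists>x. q x > 0 \<and> P x = 0) \<longleftrightarrow> q \<notin> dists_on {x. P x \<noteq> 0}"
    using assms is_dist_nonneg[OF assms] by (auto simp: dists_on_def less_le)
  ultimately show ?thesis by (simp add: rel_ent_def kl_def)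
qed

lemma compact_dists_on: "compact (dists_on S)"
proof -
  have "closed (\<Inter>x\<in>-S. {q :: 'a \<Rightarrow> real. q x = 0})"
    by (intro closed_INT ballI closed_Collect_eq continuous_on_product_coordinates continuous_on_const)
  then have "compact ({q. is_dist q} \<inter> (\<Inter>x\<in>-S. {q. q x = 0}))"
    using compact_dists by (rule compact_Int_closed[rotated])
  moreover have "{q. is_dist q} \<inter> (\<Inter>x\<in>-S. {q. q x = 0}) = dists_on S"
    by (auto simp: dists_on_def)
  ultimately show ?thesis by simp
qed

lemma dists_on_mix:
  assumes "p \<in> dists_on S" "q \<in> dists_on S" "0 \<le> t" "t \<le> 1"
  shows "(\<lambda>x. t * p x + (1 - t) * q x) \<in> dists_on S"
  using assms is_dist_mix[of p q t] by (simp add: dists_on_def)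

lemma kl_self: "kl P P = 0"
  unfolding kl_def
proof (intro sum.neutral ballI)
  show "P x * ln (P x / P x) = 0" for x by (cases "P x = 0") simp_all
qed

lemma continuous_on_kl:
  assumes "\<And>x. 0 \<le> P x"
  shows "continuous_on (dists_on {x. P x \<noteq> 0}) (\<lambda>q. kl q P)"
proof -
  let ?K = "dists_on {x. P x \<noteq> 0}"
  have "continuous_on ?K (\<lambda>q. \<Sum>x\<in>UNIV. q x * ln (q x) - q x * ln (P x))"
    by (intro continuous_intros continuous_on_compose2[OF continuous_on_mult_ln]
        continuous_on_product_then_coordinatewise[OF continuous_on_id])
      (auto simp: dists_on_def is_dist_nonneg)
  moreover have "kl q P = (\<Sum>x\<in>UNIV. q x * ln (q x) - q x * ln (P x))" if "q \<in> ?K" for q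
    unfolding kl_def
  proof (rule sum.cong)
    fix x
    have "0 < P x" if "0 < q x" using assms[of x] that \<open>q \<in> ?K\<close> by (auto simp: dists_on_def less_le)
    moreover have "0 \<le> q x" using that by (simp add: dists_on_def is_dist_nonneg)
    ultimately show "q x * ln (q x / P x) = q x * ln (q x) - q x * ln (P x)"
      by (cases "q x = 0") (simp_all add: ln_div algebra_simps)
  qed simp
  ultimately show ?thesis by (simp cong: continuous_on_cong)
qed

lemma kl_mix:
  assumes "\<And>x. 0 \<le> P x" "p \<in> dists_on {x. P x \<noteq> 0}" "q \<in> dists_on {x. P x \<noteq> 0}"
    and t: "0 \<le> t" "t \<le> 1"
  shows "kl (\<lambda>x. t * p x + (1 - t) * q x) P \<le> t * kl p P + (1 - t) * kl q P"
proof -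
  have "(t * p x + (1 - t) * q x) * ln ((t * p x + (1 - t) * q x) / P x) \<le>
      t * (p x * ln (p x / P x)) + (1 - t) * (q x * ln (q x / P x))" for x
  proof -
    have "t * P x + (1 - t) * P x = P x" by (simp add: algebra_simps)
    then show ?thesis
      using mult_ln_divide_convex[of "p x" "q x" "P x" "P x" t] assms
      by (simp add: dists_on_def is_dist_nonneg)
  qed
  then show ?thesis
    unfolding kl_def sum_distrib_left sum.distrib[symmetric] by (intro sum_mono)
qed

section \<open>Gibbs' variational principle and the Lagrange dual over a relative entropy
  ball\<close>

context
  fixes P f :: "'x::finite \<Rightarrow> real"
  assumes P: "is_dist P"
begin

lemma partition_pos: "0 < (\<Sum>x\<in>UNIV. P x * exp (f x / \<mu>))"
proof -
  obtain x where "0 < P x" using is_dist_pos P by blast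
  then show ?thesis using is_dist_nonneg[OF P] by (intro sum_pos2[of UNIV x]) auto
qed

text \<open>The tangent inequality with \<open>b = P x * exp (f x / \<mu>)\<close> and
  \<open>s = 1 / Z\<close>, summed over \<open>x\<close>. Both \<open>q\<close> and the normalised
  weights have total mass 1, so the linear terms cancel and only \<open>- ln Z\<close>
  remains.\<close>

lemma gibbs_le:
  assumes q: "q \<in> dists_on {x. P x \<noteq> 0}" and "0 < \<mu>"
  shows "(\<Sum>x\<in>UNIV. q x * f x) - \<mu> * kl q P \<le> \<mu> * ln (\<Sum>x\<in>UNIV. P x * exp (f x / \<mu>))"
proof -
  define Z where "Z = (\<Sum>x\<in>UNIV. P x * exp (f x / \<mu>))"
  have Z: "0 < Z" unfolding Z_def by (rule partition_pos)
  have dq: "is_dist q" using q by (simp add: dists_on_def)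
  have "- q x * ln Z + q x - P x * exp (f x / \<mu>) / Z \<le> q x * ln (q x / P x) - q x * f x / \<mu>" for x
  proof -
    have "q x * ln (1 / Z) + q x - 1 / Z * (P x * exp (f x / \<mu>)) \<le>
        q x * ln (q x / (P x * exp (f x / \<mu>)))"
      using q Z is_dist_nonneg[OF P] is_dist_nonneg[OF dq]
      by (intro mult_ln_ge_tangent) (auto simp: dists_on_def)
    also have "q x * ln (q x / (P x * exp (f x / \<mu>))) = q x * ln (q x / P x) - q x * f x / \<mu>"
    proof (cases "q x = 0")
      case False
      then have "P x \<noteq> 0" using q by (auto simp: dists_on_def)
      then have "0 < P x" "0 < q x"
        using False is_dist_nonneg[OF P] is_dist_nonneg[OF dq] by (auto simp: less_le)
      then show ?thesis by (simp add: ln_div ln_mult algebra_simps)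
    qed simp
    finally show ?thesis using Z by (simp add: ln_div)
  qed
  then have "(\<Sum>x\<in>UNIV. - q x * ln Z + q x - P x * exp (f x / \<mu>) / Z) \<le>
      (\<Sum>x\<in>UNIV. q x * ln (q x / P x) - q x * f x / \<mu>)"
    by (rule sum_mono)
  also have "(\<Sum>x\<in>UNIV. - q x * ln Z + q x - P x * exp (f x / \<mu>) / Z) = - ln Z"
    using Z is_dist_sum[OF dq]
    by (simp add: sum.distrib sum_subtractf sum_negf flip: sum_distrib_right sum_divide_distrib Z_def)
  also have "(\<Sum>x\<in>UNIV. q x * ln (q x / P x) - q x * f x / \<mu>) = kl q P - (\<Sum>x\<in>UNIV. q x * f x) / \<mu>"
    by (simp add: kl_def sum_subtractf sum_divide_distrib)
  finally have "\<mu> * ((\<Sum>x\<in>UNIV. q x * f x) / \<mu> - kl q P) \<le> \<mu> * ln Z"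
    using \<open>0 < \<mu>\<close> by (intro mult_left_mono) auto
  then show ?thesis using \<open>0 < \<mu>\<close> by (simp add: Z_def right_diff_distrib)
qed

text \<open>The maximiser is \<open>P\<close> tilted by \<open>exp (f x / \<mu>)\<close>: its
  log-ratio to \<open>P\<close> is \<open>f x / \<mu> - ln Z\<close> on the support of
  \<open>P\<close>, which gives equality letter by letter.\<close>

lemma gibbs_attained:
  assumes "0 < \<mu>"
  obtains q where "q \<in> dists_on {x. P x \<noteq> 0}"
    "(\<Sum>x\<in>UNIV. q x * f x) - \<mu> * kl q P = \<mu> * ln (\<Sum>x\<in>UNIV. P x * exp (f x / \<mu>))"
proof -
  define Z where "Z = (\<Sum>x\<in>UNIV. P x * exp (f x / \<mu>))"
  have Z: "0 < Z" unfolding Z_def by (rule partition_pos)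
  define q where "q x = P x * exp (f x / \<mu>) / Z" for x
  have dq: "is_dist q"
    using Z is_dist_nonneg[OF P] by (simp add: is_dist_def q_def flip: sum_divide_distrib Z_def)
  have "q x * f x - \<mu> * (q x * ln (q x / P x)) = q x * (\<mu> * ln Z)" for x
  proof (cases "P x = 0")
    case False
    then have "q x / P x = exp (f x / \<mu>) / Z" by (simp add: q_def)
    then have ln: "ln (q x / P x) = f x / \<mu> - ln Z" using Z by (simp add: ln_div)
    show ?thesis unfolding ln using assms by (simp add: right_diff_distrib)
  qed (simp add: q_def)
  then have "(\<Sum>x\<in>UNIV. q x * f x) - \<mu> * kl q P = (\<Sum>x\<in>UNIV. q x * (\<mu> * ln Z))"
    unfolding kl_def sum_distrib_left sum_subtractf[symmetric] by (intro sum.cong) auto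
  also have "\<dots> = \<mu> * ln Z" using is_dist_sum[OF dq] by (simp flip: sum_distrib_right)
  finally show ?thesis using that[of q] dq by (simp add: dists_on_def q_def Z_def)
qed

text \<open>\<open>L 0\<close> is only required to bound \<open>f\<close> from above: at \<open>\<mu> = 0\<close> the function \<open>G\<close> takes the
  maximum over all letters, not over the support of \<open>P\<close>. The minimax argument therefore runs over
  \<open>\<mu> > 0\<close>, and \<open>\<mu> = 0\<close> only enters through weak duality.\<close>

lemma SUP_rel_ent_ball_eq_INF:
  assumes E: "0 \<le> E"
    and L0: "\<And>x. f x \<le> L 0"
    and L: "\<And>\<mu>. 0 < \<mu> \<Longrightarrow> L \<mu> = \<mu> * ln (\<Sum>x\<in>UNIV. P x * exp (f x / \<mu>))"
  shows "(SUP q\<in>{q. is_dist q \<and> rel_ent q P \<le> ereal E}. ereal (c + (\<Sum>x\<in>UNIV. q x * f x))) =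
    (INF \<mu>\<in>{0..}. ereal (c + \<mu> * E + L \<mu>))"
proof -
  let ?K = "dists_on {x. P x \<noteq> 0}"
  let ?Q = "{q. is_dist q \<and> rel_ent q P \<le> ereal E}"
  let ?F = "\<lambda>q. c + (\<Sum>x\<in>UNIV. q x * f x)"
  let ?g = "\<lambda>q \<mu>. ?F q - \<mu> * (kl q P - E)"
  have Q: "?Q = {q\<in>?K. kl q P \<le> E}"
    using rel_ent_le_iff[of _ P E] by (auto simp: dists_on_def)
  have PK: "P \<in> ?K" using P by (simp add: dists_on_def)
  then have PQ: "P \<in> ?Q" using E kl_self[of P] unfolding Q by simp
  show ?thesis
  proof (rule antisym)
    show "(SUP q\<in>?Q. ereal (?F q)) \<le> (INF \<mu>\<in>{0..}. ereal (c + \<mu> * E + L \<mu>))"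
    proof (intro SUP_least INF_greatest)
      fix q \<mu> assume "q \<in> ?Q" and "\<mu> \<in> {0::real..}"
      then have q: "q \<in> ?K" "kl q P \<le> E" "is_dist q" unfolding Q by (auto simp: dists_on_def)
      show "ereal (?F q) \<le> ereal (c + \<mu> * E + L \<mu>)"
      proof (cases "\<mu> = 0")
        case True
        then show ?thesis using is_dist_expectation_le[OF q(3) L0] by simp
      next
        case False
        then have "0 < \<mu>" using \<open>\<mu> \<in> {0..}\<close> by simp
        moreover have "\<mu> * kl q P \<le> \<mu> * E" using q \<open>0 < \<mu>\<close> by simp
        ultimately have "?F q \<le> c + \<mu> * E + L \<mu>"
          using gibbs_le[OF q(1) \<open>0 < \<mu>\<close>] L[OF \<open>0 < \<mu>\<close>] by linarith
        then show ?thesis by simp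
      qed
    qed
    have "(INF \<mu>\<in>{0..}. ereal (c + \<mu> * E + L \<mu>)) \<le> (INF \<mu>\<in>{0<..}. ereal (c + \<mu> * E + L \<mu>))"
      by (rule INF_superset_mono) auto
    \<comment> \<open>For each positive \<open>\<mu>\<close> the tilted distribution from
      \<open>gibbs_attained\<close> gives the Lagrangian exactly the value of the dual
      objective.\<close>
    also have "\<dots> \<le> (INF \<mu>\<in>{0<..}. SUP q\<in>?K. ereal (?g q \<mu>))"
    proof (rule INF_mono)
      fix \<mu> :: real assume \<mu>: "\<mu> \<in> {0<..}"
      then obtain q where q: "q \<in> ?K"
        "(\<Sum>x\<in>UNIV. q x * f x) - \<mu> * kl q P = \<mu> * ln (\<Sum>x\<in>UNIV. P x * exp (f x / \<mu>))"
        using gibbs_attained[of \<mu>] by auto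
      have "c + \<mu> * E + L \<mu> = ?g q \<mu>"
        using q(2) L[of \<mu>] \<mu> by (simp add: right_diff_distrib)
      then have "ereal (c + \<mu> * E + L \<mu>) \<le> (SUP q\<in>?K. ereal (?g q \<mu>))"
        using q(1) by (intro SUP_upper2[of q]) auto
      then show "\<exists>\<mu>'\<in>{0<..}. ereal (c + \<mu>' * E + L \<mu>') \<le> (SUP q\<in>?K. ereal (?g q \<mu>))"
        using \<mu> by blast
    qed
    also have "\<dots> = (SUP q\<in>?K. INF \<mu>\<in>{0<..}. ereal (?g q \<mu>))"
    proof (rule fan_maximin[symmetric])
      show "compact ?K" by (rule compact_dists_on)
      show "{0::real<..} \<noteq> {}" by simp
      show "continuous_on ?K (\<lambda>q. ?g q \<mu>)" for \<mu>
        using continuous_on_kl[OF is_dist_nonneg[OF P]]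
        by (intro continuous_intros continuous_on_product_then_coordinatewise[OF continuous_on_id])
      show "convexlike_on ?K {0<..} (\<lambda>q \<mu>. - ?g q \<mu>)"
      proof (rule convexlike_onI[where g = "\<lambda>p q t x. t * p x + (1 - t) * q x"])
        fix p q and t \<mu> :: real
        assume *: "p \<in> ?K" "q \<in> ?K" "0 \<le> t" "t \<le> 1"
        then show "(\<lambda>x. t * p x + (1 - t) * q x) \<in> ?K" by (rule dists_on_mix)
        assume "\<mu> \<in> {0<..}"
        then have "\<mu> * kl (\<lambda>x. t * p x + (1 - t) * q x) P \<le> \<mu> * (t * kl p P + (1 - t) * kl q P)"
          using kl_mix[OF is_dist_nonneg[OF P] *] by (intro mult_left_mono) auto
        moreover have "(\<Sum>x\<in>UNIV. (t * p x + (1 - t) * q x) * f x) =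
            t * (\<Sum>x\<in>UNIV. p x * f x) + (1 - t) * (\<Sum>x\<in>UNIV. q x * f x)"
          by (simp add: distrib_right sum.distrib sum_distrib_left mult.assoc)
        ultimately show "- ?g (\<lambda>x. t * p x + (1 - t) * q x) \<mu> \<le> t * - ?g p \<mu> + (1 - t) * - ?g q \<mu>"
          by (simp add: algebra_simps)
      qed
      show "convexlike_on {0<..} ?K (\<lambda>\<mu> q. ?g q \<mu>)"
      proof (rule convexlike_onI[where g = "\<lambda>a b t. t * a + (1 - t) * b"])
        fix a b t :: real assume *: "a \<in> {0<..}" "b \<in> {0<..}" "0 \<le> t" "t \<le> 1"
        then show "t * a + (1 - t) * b \<in> {0<..}"
          using convexD[of "{0<..}" a b t "1 - t"] by simp
      qed (simp add: algebra_simps)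
    qed
    also have "\<dots> \<le> (SUP q\<in>?Q. ereal (?F q))"
    proof (rule SUP_least)
      fix q assume q: "q \<in> ?K"
      show "(INF \<mu>\<in>{0<..}. ereal (?g q \<mu>)) \<le> (SUP q\<in>?Q. ereal (?F q))"
      proof (cases "kl q P \<le> E")
        case True
        have "(INF \<mu>\<in>{0<..}. ereal (?g q \<mu>)) \<le> ereal (?F q)"
        proof (rule ereal_le_epsilon2)
          fix e :: real assume "0 < e"
          \<comment> \<open>For feasible \<open>q\<close> the slack term is made small by a small
            multiplier: this one bounds it by \<open>e\<close>. The summand 1 keeps the denominator
            positive when \<open>kl q P = E\<close>.\<close>
          let ?\<mu> = "e / (E - kl q P + 1)"
          have "0 < ?\<mu>" using \<open>0 < e\<close> True by simp
          then have "(INF \<mu>\<in>{0<..}. ereal (?g q \<mu>)) \<le> ereal (?g q ?\<mu>)"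
            by (intro INF_lower) auto
          also have "?g q ?\<mu> \<le> ?F q + e"
          proof -
            have "?\<mu> * (E - kl q P) \<le> ?\<mu> * (E - kl q P + 1)"
              using \<open>0 < ?\<mu>\<close> by (intro mult_left_mono) auto
            also have "\<dots> = e" using True by simp
            finally show ?thesis by (simp add: right_diff_distrib)
          qed
          finally show "(INF \<mu>\<in>{0<..}. ereal (?g q \<mu>)) \<le> ereal (?F q) + ereal e" by simp
        qed
        also have "\<dots> \<le> (SUP q\<in>?Q. ereal (?F q))"
          using q True unfolding Q by (intro SUP_upper) simp
        finally show ?thesis .
      next
        case False
        \<comment> \<open>For infeasible \<open>q\<close> a large multiplier pushes the Lagrangian
          below the value at \<open>P\<close>, which lies in every ball. The summand 1 keeps
          \<open>?\<mu>\<close> positive when both values coincide.\<close>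
        let ?\<mu> = "(\<bar>?F q - ?F P\<bar> + 1) / (kl q P - E)"
        have "0 < ?\<mu>" using False by (intro divide_pos_pos) auto
        then have "(INF \<mu>\<in>{0<..}. ereal (?g q \<mu>)) \<le> ereal (?g q ?\<mu>)"
          by (intro INF_lower) auto
        also have "?g q ?\<mu> \<le> ?F P"
        proof -
          have "?\<mu> * (kl q P - E) = \<bar>?F q - ?F P\<bar> + 1" using False by simp
          then show ?thesis by linarith
        qed
        then have "ereal (?g q ?\<mu>) \<le> ereal (?F P)" by simp
        also have "\<dots> \<le> (SUP q\<in>?Q. ereal (?F q))" using PQ by (rule SUP_upper)
        finally show ?thesis .
      qed
    qed
    finally show "(INF \<mu>\<in>{0..}. ereal (c + \<mu> * E + L \<mu>)) \<le> (SUP q\<in>?Q. ereal (?F q))" .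
  qed
qed

end

section \<open>Duality for the rate-distortion function\<close>

lemma mutual_info_eq: "mutual_info q V = (\<Sum>x\<in>UNIV. \<Sum>y\<in>UNIV. q x * (V x y * ln (V x y / out_dist q V y)))"
  unfolding mutual_info_def by (intro sum.cong) auto

lemma out_dist_is_dist:
  assumes "is_dist q" "is_cond_dist V"
  shows "is_dist (out_dist q V)"
proof -
  have "(\<Sum>y\<in>UNIV. out_dist q V y) = (\<Sum>x\<in>UNIV. q x * (\<Sum>y\<in>UNIV. V x y))"
    unfolding out_dist_def sum_distrib_left by (rule sum.swap)
  then show ?thesis
    using assms by (auto simp: is_dist_def is_cond_dist_def out_dist_def intro!: sum_nonneg)
qed

lemma out_dist_eq_0D:
  assumes "is_dist q" "is_cond_dist V" "out_dist q V y = 0" "q x \<noteq> 0"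
  shows "V x y = 0"
proof -
  have "\<forall>x\<in>UNIV. q x * V x y = 0"
    using assms(1,2,3) by (subst sum_nonneg_eq_0_iff[symmetric])
      (auto simp: is_dist_def is_cond_dist_def out_dist_def)
  then show ?thesis using assms(4) by auto
qed

text \<open>The output distribution is linear in the channel, so the joint convexity of
  \<open>a * ln (a / b)\<close> applies to each pair of letters.\<close>

lemma mutual_info_mix:
  assumes q: "is_dist q" and V: "is_cond_dist V" and W: "is_cond_dist W" and t: "0 \<le> t" "t \<le> 1"
  shows "mutual_info q (\<lambda>x y. t * V x y + (1 - t) * W x y) \<le>
    t * mutual_info q V + (1 - t) * mutual_info q W"
proof -
  let ?U = "\<lambda>x y. t * V x y + (1 - t) * W x y"
  have out: "out_dist q ?U y = t * out_dist q V y + (1 - t) * out_dist q W y" for y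
    unfolding out_dist_def sum_distrib_left sum.distrib[symmetric]
    by (intro sum.cong) (auto simp: algebra_simps)
  have "q x * (?U x y * ln (?U x y / out_dist q ?U y)) \<le>
      t * (q x * (V x y * ln (V x y / out_dist q V y))) +
      (1 - t) * (q x * (W x y * ln (W x y / out_dist q W y)))" for x y
  proof (cases "q x = 0")
    case False
    have "?U x y * ln (?U x y / out_dist q ?U y) \<le>
        t * (V x y * ln (V x y / out_dist q V y)) + (1 - t) * (W x y * ln (W x y / out_dist q W y))"
      unfolding out
      using V W t out_dist_eq_0D[OF q V _ False] out_dist_eq_0D[OF q W _ False]
        is_dist_nonneg[OF out_dist_is_dist[OF q V]] is_dist_nonneg[OF out_dist_is_dist[OF q W]]
      by (intro mult_ln_divide_convex) (auto simp: is_cond_dist_def is_dist_nonneg)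
    from mult_left_mono[OF this is_dist_nonneg[OF q, of x]] show ?thesis
      by (simp add: algebra_simps)
  qed simp
  then show ?thesis
    unfolding mutual_info_eq sum_distrib_left sum.distrib[symmetric] by (intro sum_mono)
qed

lemma continuous_on_mutual_info:
  assumes q: "is_dist q"
  shows "continuous_on {V. is_cond_dist V} (\<lambda>V :: 'a::finite \<Rightarrow> 'b::finite \<Rightarrow> real. mutual_info q V)"
proof -
  \<comment> \<open>The quotient inside the logarithm is singular where the output probability
    vanishes. Splitting the logarithm leaves only terms of the form \<open>t * ln t\<close>,
    continuous up to 0.\<close>
  let ?J = "\<lambda>V :: 'a \<Rightarrow> 'b \<Rightarrow> real. (\<Sum>x\<in>UNIV. \<Sum>y\<in>UNIV. q x * (V x y * ln (V x y))) -
    (\<Sum>y\<in>UNIV. out_dist q V y * ln (out_dist q V y))"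
  have out: "continuous_on {V. is_cond_dist V} (\<lambda>V :: 'a \<Rightarrow> 'b \<Rightarrow> real. out_dist q V y)" for y
    unfolding out_dist_def by (intro continuous_intros continuous_on_cond_coordinate)
  have J: "continuous_on {V. is_cond_dist V} ?J"
  proof (intro continuous_on_diff continuous_on_sum continuous_on_mult_left)
    show "continuous_on {V. is_cond_dist V} (\<lambda>V :: 'a \<Rightarrow> 'b \<Rightarrow> real. V x y * ln (V x y))" for x y
      by (rule continuous_on_compose2[OF continuous_on_mult_ln continuous_on_cond_coordinate])
        (auto simp: is_cond_dist_def is_dist_nonneg)
    show "continuous_on {V. is_cond_dist V} (\<lambda>V :: 'a \<Rightarrow> 'b \<Rightarrow> real. out_dist q V y * ln (out_dist q V y))" for y
      by (rule continuous_on_compose2[OF continuous_on_mult_ln out])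
        (auto simp: is_dist_nonneg out_dist_is_dist[OF q])
  qed
  have eq: "mutual_info q V = ?J V" if V: "is_cond_dist V" for V
  proof -
    have "q x * (V x y * ln (V x y / out_dist q V y)) =
        q x * (V x y * ln (V x y)) - q x * V x y * ln (out_dist q V y)" for x y
    proof (cases "q x * V x y = 0")
      case False
      then have "out_dist q V y \<noteq> 0" using out_dist_eq_0D[OF q V] by auto
      then have "0 < out_dist q V y" "0 < V x y"
        using False V is_dist_nonneg[OF out_dist_is_dist[OF q V]]
        by (auto simp: less_le is_cond_dist_def is_dist_nonneg)
      then show ?thesis by (simp add: ln_div algebra_simps)
    qed auto
    then have "mutual_info q V = (\<Sum>x\<in>UNIV. \<Sum>y\<in>UNIV. q x * (V x y * ln (V x y))) -
        (\<Sum>x\<in>UNIV. \<Sum>y\<in>UNIV. q x * V x y * ln (out_dist q V y))"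
      by (simp add: mutual_info_eq sum_subtractf)
    also have "(\<Sum>x\<in>UNIV. \<Sum>y\<in>UNIV. q x * V x y * ln (out_dist q V y)) =
        (\<Sum>y\<in>UNIV. out_dist q V y * ln (out_dist q V y))"
      unfolding out_dist_def sum_distrib_right by (rule sum.swap)
    finally show ?thesis .
  qed
  show ?thesis by (rule continuous_on_eq[OF J]) (simp add: eq)
qed

text \<open>The gap between the two sides is the relative entropy of the output distribution with
  respect to \<open>p\<close>, nonnegative by the tangent inequality with
  \<open>s = 1\<close>.\<close>

lemma mutual_info_le:
  assumes q: "is_dist q" and V: "is_cond_dist V" and p: "is_dist p"
    and abs: "\<And>x y. p y = 0 \<Longrightarrow> V x y = 0"
  shows "mutual_info q V \<le> (\<Sum>x\<in>UNIV. \<Sum>y\<in>UNIV. q x * (V x y * ln (V x y / p y)))"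
proof -
  let ?o = "out_dist q V"
  have o: "is_dist ?o" by (rule out_dist_is_dist[OF q V])
  have "(\<Sum>y\<in>UNIV. ?o y - p y) \<le> (\<Sum>y\<in>UNIV. ?o y * ln (?o y / p y))"
  proof (rule sum_mono)
    fix y
    have "?o y * ln 1 + ?o y - 1 * p y \<le> ?o y * ln (?o y / p y)"
      using is_dist_nonneg[OF o] is_dist_nonneg[OF p] abs
      by (intro mult_ln_ge_tangent) (auto simp: out_dist_def)
    then show "?o y - p y \<le> ?o y * ln (?o y / p y)" by simp
  qed
  then have "0 \<le> (\<Sum>y\<in>UNIV. ?o y * ln (?o y / p y))"
    using is_dist_sum[OF o] is_dist_sum[OF p] by (simp add: sum_subtractf)
  also have "\<dots> = (\<Sum>x\<in>UNIV. \<Sum>y\<in>UNIV. q x * V x y * ln (?o y / p y))"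
    unfolding out_dist_def sum_distrib_right by (rule sum.swap)
  also have "\<dots> = (\<Sum>x\<in>UNIV. \<Sum>y\<in>UNIV.
      q x * (V x y * ln (V x y / p y)) - q x * (V x y * ln (V x y / ?o y)))"
  proof (intro sum.cong refl)
    fix x y
    show "q x * V x y * ln (?o y / p y) =
        q x * (V x y * ln (V x y / p y)) - q x * (V x y * ln (V x y / ?o y))"
    proof (cases "q x * V x y = 0")
      case False
      then have "?o y \<noteq> 0" "p y \<noteq> 0" using out_dist_eq_0D[OF q V] abs by auto
      then have "0 < ?o y" "0 < p y" "0 < V x y"
        using False V is_dist_nonneg[OF o] is_dist_nonneg[OF p]
        by (auto simp: less_le is_cond_dist_def is_dist_nonneg)
      then show ?thesis by (simp add: ln_div algebra_simps)
    qed auto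
  qed
  finally show ?thesis by (simp add: mutual_info_eq sum_subtractf)
qed

section \<open>Minimising mutual information plus weighted distortion; the dual of the
  rate-distortion function\<close>

definition distortion :: "('a::finite \<Rightarrow> 'b::finite \<Rightarrow> real) \<Rightarrow> ('a \<Rightarrow> real) \<Rightarrow> ('a \<Rightarrow> 'b \<Rightarrow> real) \<Rightarrow> real" where
  "distortion d q V = (\<Sum>x\<in>UNIV. \<Sum>y\<in>UNIV. q x * V x y * d x y)"

text \<open>The inner sum of both branches of \<open>G_fun\<close>, and the normalising constant of
  the exponentially tilted channel built from \<open>p\<close>.\<close>

definition tilted :: "('a \<Rightarrow> 'b::finite \<Rightarrow> real) \<Rightarrow> real \<Rightarrow> ('b \<Rightarrow> real) \<Rightarrow> 'a \<Rightarrow> real" where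
  "tilted d \<nu> p x = (\<Sum>y\<in>UNIV. p y * exp (- \<nu> * d x y))"

lemma tilted_pos:
  assumes "is_dist p"
  shows "0 < tilted d \<nu> p x"
proof -
  obtain y where "0 < p y" using is_dist_pos assms by blast
  then show ?thesis
    unfolding tilted_def using is_dist_nonneg[OF assms] by (intro sum_pos2[of UNIV y]) auto
qed

lemma tilted_le_1:
  assumes "is_dist p" "\<And>y. 0 \<le> d x y" "0 \<le> \<nu>"
  shows "tilted d \<nu> p x \<le> 1"
  unfolding tilted_def using assms by (intro is_dist_expectation_le) simp_all

lemma tilted_mix:
  "tilted d \<nu> (\<lambda>y. t * p y + (1 - t) * p' y) x = t * tilted d \<nu> p x + (1 - t) * tilted d \<nu> p' x"
  by (simp add: tilted_def distrib_right sum.distrib sum_distrib_left mult.assoc)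

text \<open>For each \<open>x\<close> of positive mass, the tangent inequality against
  \<open>?p y * exp (- \<nu> * d x y)\<close> with \<open>s = 1 / ?Z\<close> is summed over
  \<open>y\<close>; this is Gibbs' bound on the output side, with \<open>p\<close> the output
  distribution of \<open>V\<close> itself.\<close>

lemma mutual_info_distortion_ge:
  assumes q: "is_dist q" and V: "is_cond_dist V"
  shows "(\<Sum>x\<in>UNIV. q x * - ln (tilted d \<nu> (out_dist q V) x)) \<le> mutual_info q V + \<nu> * distortion d q V"
proof -
  let ?p = "out_dist q V"
  have p: "is_dist ?p" by (rule out_dist_is_dist[OF q V])
  have "q x * - ln (tilted d \<nu> ?p x) \<le>
      (\<Sum>y\<in>UNIV. q x * (V x y * ln (V x y / ?p y)) + \<nu> * (q x * V x y * d x y))" for x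
  proof (cases "q x = 0")
    case False
    let ?Z = "tilted d \<nu> ?p x"
    have Z: "0 < ?Z" by (rule tilted_pos[OF p])
    have Vx: "is_dist (V x)" using V by (simp add: is_cond_dist_def)
    have "V x y * ln (1 / ?Z) + V x y - 1 / ?Z * (?p y * exp (- \<nu> * d x y)) \<le>
        V x y * ln (V x y / ?p y) + \<nu> * (V x y * d x y)" for y
    proof -
      have "V x y * ln (1 / ?Z) + V x y - 1 / ?Z * (?p y * exp (- \<nu> * d x y)) \<le>
          V x y * ln (V x y / (?p y * exp (- \<nu> * d x y)))"
        using out_dist_eq_0D[OF q V _ False] is_dist_nonneg[OF p] is_dist_nonneg[OF Vx] Z
        by (intro mult_ln_ge_tangent) auto
      also have "\<dots> = V x y * ln (V x y / ?p y) + \<nu> * (V x y * d x y)"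
      proof (cases "V x y = 0")
        case nz: False
        then have "?p y \<noteq> 0" using out_dist_eq_0D[OF q V _ False] by auto
        then have "0 < ?p y" "0 < V x y"
          using nz is_dist_nonneg[OF p] is_dist_nonneg[OF Vx] by (auto simp: less_le)
        then show ?thesis by (simp add: ln_div ln_mult algebra_simps)
      qed simp
      finally show ?thesis .
    qed
    then have "(\<Sum>y\<in>UNIV. V x y * ln (1 / ?Z) + V x y - 1 / ?Z * (?p y * exp (- \<nu> * d x y))) \<le>
        (\<Sum>y\<in>UNIV. V x y * ln (V x y / ?p y) + \<nu> * (V x y * d x y))"
      by (rule sum_mono)
    also have "(\<Sum>y\<in>UNIV. V x y * ln (1 / ?Z) + V x y - 1 / ?Z * (?p y * exp (- \<nu> * d x y))) =
        (\<Sum>y\<in>UNIV. V x y) * ln (1 / ?Z) + (\<Sum>y\<in>UNIV. V x y) - 1 / ?Z * ?Z"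
      by (simp only: sum.distrib sum_subtractf sum_distrib_right sum_distrib_left tilted_def)
    also have "\<dots> = - ln ?Z" using Z is_dist_sum[OF Vx] by (simp add: ln_div)
    finally have "q x * - ln ?Z \<le> q x * (\<Sum>y\<in>UNIV. V x y * ln (V x y / ?p y) + \<nu> * (V x y * d x y))"
      using is_dist_nonneg[OF q] by (intro mult_left_mono) auto
    also have "\<dots> = (\<Sum>y\<in>UNIV. q x * (V x y * ln (V x y / ?p y)) + \<nu> * (q x * V x y * d x y))"
      unfolding sum_distrib_left by (intro sum.cong) (auto simp: algebra_simps)
    finally show ?thesis .
  qed simp
  then have "(\<Sum>x\<in>UNIV. q x * - ln (tilted d \<nu> ?p x)) \<le>
      (\<Sum>x\<in>UNIV. \<Sum>y\<in>UNIV. q x * (V x y * ln (V x y / ?p y)) + \<nu> * (q x * V x y * d x y))"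
    by (rule sum_mono)
  then show ?thesis
    by (simp add: mutual_info_eq distortion_def sum.distrib sum_distrib_left)
qed

text \<open>The channel with weights proportional to \<open>p y * exp (- \<nu> * d x y)\<close>
  gives equality if \<open>p\<close> stands in the logarithm instead of the true output
  distribution; by \<open>mutual_info_le\<close> the true one only lowers the value. With the
  preceding lemma, the infima over channels and over output distributions coincide.\<close>

lemma mutual_info_distortion_le:
  assumes q: "is_dist q" and p: "is_dist p"
  obtains V where "is_cond_dist V"
    "mutual_info q V + \<nu> * distortion d q V \<le> (\<Sum>x\<in>UNIV. q x * - ln (tilted d \<nu> p x))"
proof -
  define V where "V x y = p y * exp (- \<nu> * d x y) / tilted d \<nu> p x" for x y
  have Z: "0 < tilted d \<nu> p x" for x by (rule tilted_pos[OF p])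
  have V: "is_cond_dist V"
    unfolding is_cond_dist_def
  proof
    fix x
    have "(\<Sum>y\<in>UNIV. V x y) = 1"
      using Z[of x] by (simp add: V_def flip: sum_divide_distrib tilted_def[of d \<nu> p x, simplified])
    then show "is_dist (V x)" using Z[of x] is_dist_nonneg[OF p] by (simp add: is_dist_def V_def)
  qed
  have "q x * (V x y * ln (V x y / p y)) + \<nu> * (q x * V x y * d x y) =
      q x * - ln (tilted d \<nu> p x) * V x y" for x y
  proof (cases "p y = 0")
    case False
    then have "V x y / p y = exp (- \<nu> * d x y) / tilted d \<nu> p x" by (simp add: V_def)
    then have ln: "ln (V x y / p y) = - \<nu> * d x y - ln (tilted d \<nu> p x)"
      using Z[of x] by (simp add: ln_div)
    show ?thesis unfolding ln by (simp add: algebra_simps)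
  qed (simp add: V_def)
  then have "(\<Sum>x\<in>UNIV. \<Sum>y\<in>UNIV. q x * (V x y * ln (V x y / p y))) + \<nu> * distortion d q V =
      (\<Sum>x\<in>UNIV. \<Sum>y\<in>UNIV. q x * - ln (tilted d \<nu> p x) * V x y)"
    by (simp only: distortion_def sum_distrib_left sum.distrib[symmetric])
  also have "\<dots> = (\<Sum>x\<in>UNIV. q x * - ln (tilted d \<nu> p x))"
  proof (rule sum.cong)
    fix x
    have "(\<Sum>y\<in>UNIV. V x y) = 1" using V by (simp add: is_cond_dist_def is_dist_def)
    then show "(\<Sum>y\<in>UNIV. q x * - ln (tilted d \<nu> p x) * V x y) = q x * - ln (tilted d \<nu> p x)"
      by (simp only: sum_distrib_left[symmetric] mult_1_right)
  qed simp
  finally show ?thesis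
    using that[OF V] mutual_info_le[OF q V p] by (simp add: V_def)
qed

lemma mutual_info_nonneg:
  assumes "is_dist q" "is_cond_dist V"
  shows "0 \<le> mutual_info q V"
  using mutual_info_distortion_ge[OF assms, of _ 0] is_dist_sum[OF out_dist_is_dist[OF assms]]
  by (simp add: tilted_def)

text \<open>Moves the infima of the definitions, taken in the reals, to the extended reals, where
  infima and suprema can be exchanged without side conditions.\<close>

lemma ereal_add_Inf_Collect:
  fixes g :: "'a \<Rightarrow> real"
  assumes "bdd_below (g ` Collect D)" "Collect D \<noteq> {}"
  shows "ereal (c + Inf {g p | p. D p}) = (INF p\<in>Collect D. ereal (c + g p))"
proof -
  let ?S = "g ` Collect D"
  have "{g p | p. D p} = ?S" by auto
  moreover have "c + Inf ?S = (INF r\<in>?S. c + r)"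
    using assms by (intro continuous_at_Inf_mono) (auto simp: mono_def intro!: continuous_intros)
  moreover have "bdd_below ((\<lambda>p. c + g p) ` Collect D)"
  proof -
    obtain b where "\<And>p. D p \<Longrightarrow> b \<le> g p" using assms(1) by (auto simp: bdd_below_def)
    then show ?thesis by (intro bdd_belowI[of _ "c + b"]) auto
  qed
  then have "ereal (INF p\<in>Collect D. c + g p) = (INF p\<in>Collect D. ereal (c + g p))"
    using ereal_Inf'[of "(\<lambda>p. c + g p) ` Collect D"] assms(2) by (simp add: image_comp)
  ultimately show ?thesis by (simp add: image_comp)
qed

text \<open>The constraint becomes a supremum over multipliers \<open>\<nu>\<close>, Fan's theorem
  with the compact set of channels moves it outside, and for fixed \<open>\<nu>\<close> the two
  preceding bounds trade channels for output distributions.\<close>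

lemma rate_dist_eq_SUP:
  fixes d :: "'x::finite \<Rightarrow> 'y::finite \<Rightarrow> real"
  assumes q: "is_dist q" and zero: "\<And>x. \<exists>y. d x y = 0" and \<Delta>: "0 \<le> \<Delta>"
  shows "ereal (rate_dist d \<Delta> q) = (SUP \<nu>\<in>{0..}. INF p\<in>{p. is_dist p}.
    ereal (- \<nu> * \<Delta> + (\<Sum>x\<in>UNIV. q x * - ln (tilted d \<nu> p x))))"
proof -
  let ?K = "{V :: 'x \<Rightarrow> 'y \<Rightarrow> real. is_cond_dist V}"
  let ?F = "{V :: 'x \<Rightarrow> 'y \<Rightarrow> real. is_cond_dist V \<and> distortion d q V \<le> \<Delta>}"
  let ?g = "\<lambda>V \<nu>. mutual_info q V + \<nu> * (distortion d q V - \<Delta>)"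
  have mix: "m + \<nu> * (e - \<Delta>) \<le> t * (m1 + \<nu> * (e1 - \<Delta>)) + (1 - t) * (m2 + \<nu> * (e2 - \<Delta>))"
    if "m \<le> t * m1 + (1 - t) * m2" and e: "e = t * e1 + (1 - t) * e2" for m m1 m2 e e1 e2 t \<nu> :: real
    unfolding e using that(1) by (simp add: algebra_simps)
  obtain r where r: "\<And>x. d x (r x) = 0" using zero by metis
  \<comment> \<open>The deterministic zero-distortion channel is feasible for every
    \<open>\<Delta> \<ge> 0\<close>, including 0, where no strictly feasible channel exists.\<close>
  let ?W = "\<lambda>x y. if y = r x then 1 else 0 :: real"
  have "distortion d q ?W = 0"
    unfolding distortion_def by (intro sum.neutral ballI) (use r in auto)
  moreover have "is_cond_dist ?W" by (simp add: is_cond_dist_def is_dist_def)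
  ultimately have "?W \<in> ?F" using \<Delta> by simp
  then have F: "?F \<noteq> {}" by blast
  have bdd: "bdd_below (mutual_info q ` ?F)"
    using mutual_info_nonneg[OF q] by (intro bdd_belowI[of _ 0]) auto
  have "ereal (rate_dist d \<Delta> q) = (INF V\<in>?F. ereal (mutual_info q V))"
    using ereal_add_Inf_Collect[OF bdd F, of 0] by (simp add: rate_dist_def distortion_def)
  also have "\<dots> = (INF V\<in>?K. SUP \<nu>\<in>{0..}. ereal (?g V \<nu>))"
  proof (rule antisym)
    show "(INF V\<in>?F. ereal (mutual_info q V)) \<le> (INF V\<in>?K. SUP \<nu>\<in>{0..}. ereal (?g V \<nu>))"
    proof (rule INF_greatest)
      fix V assume V: "V \<in> ?K"
      show "(INF V\<in>?F. ereal (mutual_info q V)) \<le> (SUP \<nu>\<in>{0..}. ereal (?g V \<nu>))"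
      proof (cases "distortion d q V \<le> \<Delta>")
        case True
        then have "(INF V\<in>?F. ereal (mutual_info q V)) \<le> ereal (?g V 0)"
          using V by (intro INF_lower2[of V]) auto
        also have "\<dots> \<le> (SUP \<nu>\<in>{0..}. ereal (?g V \<nu>))" by (intro SUP_upper) auto
        finally show ?thesis .
      next
        case False
        let ?m = "\<bar>mutual_info q ?W - mutual_info q V\<bar>"
        \<comment> \<open>With this multiplier the penalty of the infeasible \<open>V\<close> equals
          \<open>?m\<close>, enough to reach the value of the feasible channel
          \<open>?W\<close>.\<close>
        let ?\<nu> = "?m / (distortion d q V - \<Delta>)"
        have "(INF V\<in>?F. ereal (mutual_info q V)) \<le> ereal (mutual_info q ?W)"
          using \<open>?W \<in> ?F\<close> by (rule INF_lower)
        also have "mutual_info q ?W \<le> ?g V ?\<nu>"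
        proof -
          have "?\<nu> * (distortion d q V - \<Delta>) = ?m" using False by simp
          then show ?thesis by (simp only:)
        qed
        then have "ereal (mutual_info q ?W) \<le> ereal (?g V ?\<nu>)" by simp
        also have "\<dots> \<le> (SUP \<nu>\<in>{0..}. ereal (?g V \<nu>))" using False by (intro SUP_upper) auto
        finally show ?thesis .
      qed
    qed
    show "(INF V\<in>?K. SUP \<nu>\<in>{0..}. ereal (?g V \<nu>)) \<le> (INF V\<in>?F. ereal (mutual_info q V))"
    proof (rule INF_mono)
      fix V assume V: "V \<in> ?F"
      then have "(SUP \<nu>\<in>{0..}. ereal (?g V \<nu>)) \<le> ereal (mutual_info q V)"
        by (intro SUP_least) (auto simp: mult_nonneg_nonpos)
      then show "\<exists>V'\<in>?K. (SUP \<nu>\<in>{0..}. ereal (?g V' \<nu>)) \<le> ereal (mutual_info q V)"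
        using V by blast
    qed
  qed
  also have "\<dots> = (SUP \<nu>\<in>{0..}. INF V\<in>?K. ereal (?g V \<nu>))"
  proof (rule fan_minimax)
    show "compact ?K" by (rule compact_cond_dists)
    show "{0::real..} \<noteq> {}" by simp
    show "continuous_on ?K (\<lambda>V. ?g V \<nu>)" for \<nu>
      unfolding distortion_def
      by (intro continuous_intros continuous_on_mutual_info[OF q] continuous_on_cond_coordinate)
    show "convexlike_on ?K {0..} ?g"
    proof (rule convexlike_onI[where g = "\<lambda>V W t x y. t * V x y + (1 - t) * W x y"])
      fix V W and t \<nu> :: real
      assume *: "V \<in> ?K" "W \<in> ?K" "0 \<le> t" "t \<le> 1"
      then show "(\<lambda>x y. t * V x y + (1 - t) * W x y) \<in> ?K" using is_cond_dist_mix by blast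
      have "distortion d q (\<lambda>x y. t * V x y + (1 - t) * W x y) =
          t * distortion d q V + (1 - t) * distortion d q W"
        unfolding distortion_def sum_distrib_left sum.distrib[symmetric]
        by (intro sum.cong) (auto simp: algebra_simps)
      then show "?g (\<lambda>x y. t * V x y + (1 - t) * W x y) \<nu> \<le> t * ?g V \<nu> + (1 - t) * ?g W \<nu>"
        using mutual_info_mix[OF q, of V W t] * by (intro mix) auto
    qed
    show "convexlike_on {0..} ?K (\<lambda>\<nu> V. - ?g V \<nu>)"
    proof (rule convexlike_onI[where g = "\<lambda>a b t. t * a + (1 - t) * b"])
      fix a b t :: real assume *: "a \<in> {0..}" "b \<in> {0..}" "0 \<le> t" "t \<le> 1"
      then show "t * a + (1 - t) * b \<in> {0..}" by simp
    qed (simp add: algebra_simps)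
  qed
  also have "\<dots> = (SUP \<nu>\<in>{0..}. INF p\<in>{p. is_dist p}.
    ereal (- \<nu> * \<Delta> + (\<Sum>x\<in>UNIV. q x * - ln (tilted d \<nu> p x))))"
  proof (intro SUP_cong refl antisym)
    fix \<nu> :: real
    let ?h = "\<lambda>p. - \<nu> * \<Delta> + (\<Sum>x\<in>UNIV. q x * - ln (tilted d \<nu> p x))"
    show "(INF V\<in>?K. ereal (?g V \<nu>)) \<le> (INF p\<in>{p. is_dist p}. ereal (?h p))"
    proof (rule INF_mono)
      fix p :: "'y \<Rightarrow> real" assume "p \<in> {p. is_dist p}"
      then obtain V where V: "is_cond_dist V"
          "mutual_info q V + \<nu> * distortion d q V \<le> (\<Sum>x\<in>UNIV. q x * - ln (tilted d \<nu> p x))"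
        using mutual_info_distortion_le[OF q, of p \<nu> d] by blast
      then have "?g V \<nu> \<le> ?h p" by (simp add: right_diff_distrib)
      then show "\<exists>V\<in>?K. ereal (?g V \<nu>) \<le> ereal (?h p)" using V(1) by auto
    qed
    show "(INF p\<in>{p. is_dist p}. ereal (?h p)) \<le> (INF V\<in>?K. ereal (?g V \<nu>))"
    proof (rule INF_mono)
      fix V assume "V \<in> ?K"
      then have V: "is_cond_dist V" by simp
      have "?h (out_dist q V) \<le> ?g V \<nu>"
        using mutual_info_distortion_ge[OF q V, of d \<nu>] by (simp add: right_diff_distrib)
      then show "\<exists>p\<in>{p. is_dist p}. ereal (?h p) \<le> ereal (?g V \<nu>)"
        using out_dist_is_dist[OF q V] by auto
    qed
  qed
  finally show ?thesis .
qed

lemma rate_dist_nonneg: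
  assumes "is_dist q" "\<And>x. \<exists>y. d x y = 0" "0 \<le> \<Delta>"
  shows "0 \<le> rate_dist d \<Delta> q"
proof -
  have "ereal 0 \<le> (INF p\<in>{p. is_dist p}.
      ereal (- 0 * \<Delta> + (\<Sum>x\<in>UNIV. q x * - ln (tilted d 0 p x))))"
    using assms by (intro INF_greatest) (simp add: tilted_def is_dist_def)
  also have "\<dots> \<le> ereal (rate_dist d \<Delta> q)"
    unfolding rate_dist_eq_SUP[OF assms] by (rule SUP_upper) simp
  finally show ?thesis by simp
qed

text \<open>In the dual formula the uniform \<open>p\<close> has tilted sums at least
  \<open>1 / CARD('y)\<close>, since each \<open>x\<close> has a letter of distortion 0. The bound
  is uniform in \<open>q\<close> and makes the real supremum in \<open>marton_inv\<close>
  finite.\<close>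

lemma rate_dist_le_ln_card:
  fixes d :: "'x::finite \<Rightarrow> 'y::finite \<Rightarrow> real"
  assumes q: "is_dist q" and zero: "\<And>x. \<exists>y. d x y = 0" and "0 \<le> \<Delta>"
  shows "rate_dist d \<Delta> q \<le> ln CARD('y)"
proof -
  let ?u = "\<lambda>_::'y. 1 / real CARD('y)"
  have u: "is_dist ?u" by (simp add: is_dist_def)
  have "- ln (tilted d \<nu> ?u x) \<le> ln CARD('y)" for x \<nu>
  proof -
    obtain y where "d x y = 0" using zero by blast
    then have "1 / real CARD('y) \<le> tilted d \<nu> ?u x"
      unfolding tilted_def
      using member_le_sum[of y UNIV "\<lambda>y. 1 / real CARD('y) * exp (- \<nu> * d x y)"] by simp
    then have "ln (1 / real CARD('y)) \<le> ln (tilted d \<nu> ?u x)"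
      using tilted_pos[OF u] by (intro ln_mono) auto
    then show ?thesis by (simp add: ln_div)
  qed
  then have "(\<Sum>x\<in>UNIV. q x * - ln (tilted d \<nu> ?u x)) \<le> ln CARD('y)" for \<nu>
    by (rule is_dist_expectation_le[OF q])
  moreover have "0 \<le> \<nu> \<Longrightarrow> - \<nu> * \<Delta> \<le> 0" for \<nu> using \<open>0 \<le> \<Delta>\<close> by simp
  ultimately have "0 \<le> \<nu> \<Longrightarrow>
      - \<nu> * \<Delta> + (\<Sum>x\<in>UNIV. q x * - ln (tilted d \<nu> ?u x)) \<le> ln CARD('y)" for \<nu>
    by (metis add_mono add_0)
  then have "ereal (rate_dist d \<Delta> q) \<le> ereal (ln CARD('y))"
    unfolding rate_dist_eq_SUP[OF assms] using u
    by (intro SUP_least INF_lower2[of ?u]) auto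
  then show ?thesis by simp
qed

section \<open>The function \<open>G_fun\<close> in terms of tilted sums\<close>

lemma G_fun_pos:
  assumes "0 < \<mu>" "is_dist p"
  shows "G_fun d \<mu> \<nu> p P = \<mu> * ln (\<Sum>x\<in>UNIV. P x * exp (- ln (tilted d \<nu> p x) / \<mu>))"
proof -
  have "tilted d \<nu> p x powr (- 1 / \<mu>) = exp (- ln (tilted d \<nu> p x) / \<mu>)" for x
    using tilted_pos[OF assms(2), of d \<nu> x] by (simp add: powr_def)
  then show ?thesis using assms unfolding G_fun_def tilted_def[symmetric] by simp
qed

lemma G_fun_0_ge:
  assumes "is_dist p"
  shows "- ln (tilted d \<nu> p x) \<le> G_fun d 0 \<nu> p P"
proof -
  let ?R = "range (tilted d \<nu> p)"
  have "Min ?R \<in> ?R" by (rule Min_in) auto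
  then have "0 < Min ?R" using tilted_pos[OF assms] by auto
  moreover have "Min ?R \<le> tilted d \<nu> p x" by simp
  ultimately show ?thesis
    unfolding G_fun_def tilted_def[symmetric] using tilted_pos[OF assms, of d \<nu> x] by simp
qed

text \<open>Supplies the lower bound that makes the real infimum in \<open>G_min\<close> meaningful.
  Tilted sums are at most 1, so \<open>- ln (tilted d \<nu> p x)\<close> is nonnegative.\<close>

lemma G_fun_nonneg:
  assumes P: "is_dist P" and p: "is_dist p" and d: "\<And>x y. 0 \<le> d x y" and "0 \<le> \<mu>" "0 \<le> \<nu>"
  shows "0 \<le> G_fun d \<mu> \<nu> p P"
proof -
  have nn: "0 \<le> - ln (tilted d \<nu> p x)" for x
    using tilted_le_1[OF p _ \<open>0 \<le> \<nu>\<close>, of d x] d tilted_pos[OF p, of d \<nu> x] by simp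
  show ?thesis
  proof (cases "\<mu> = 0")
    case True
    then show ?thesis using nn G_fun_0_ge[OF p] order_trans by blast
  next
    case False
    then have "0 < \<mu>" using \<open>0 \<le> \<mu>\<close> by simp
    have "(\<Sum>x\<in>UNIV. P x * 1) \<le> (\<Sum>x\<in>UNIV. P x * exp (- ln (tilted d \<nu> p x) / \<mu>))"
      using nn \<open>0 < \<mu>\<close> is_dist_nonneg[OF P]
      by (intro sum_mono mult_left_mono) (simp_all add: divide_nonpos_pos)
    then show ?thesis
      using G_fun_pos[OF \<open>0 < \<mu>\<close> p, of d \<nu> P] \<open>0 < \<mu>\<close> is_dist_sum[OF P] by simp
  qed
qed

section \<open>The dual formula for the inverse Marton function\<close>

theorem theorem1:
  fixes d :: "'x::finite \<Rightarrow> 'y::finite \<Rightarrow> real"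
    and P :: "'x \<Rightarrow> real" and E \<Delta> :: real
  assumes d_nonneg: "\<And>x y. 0 \<le> d x y"
    and d_max_min: "Max (range (\<lambda>x. Min (range (\<lambda>y. d x y)))) = 0"
    and P_dist: "is_dist P"
    and E_nonneg: "0 \<le> E"
    and Delta_nonneg: "0 \<le> \<Delta>"
    and Delta_le: "\<Delta> \<le> Min (range (\<lambda>y. \<Sum>x\<in>UNIV. P x * d x y))"
  shows "ereal (marton_inv d E \<Delta> P) =
    (SUP \<nu>\<in>{0..}. INF \<mu>\<in>{0..}. ereal (- \<nu> * \<Delta> + \<mu> * E + G_min d \<mu> \<nu> P))"
proof -
  let ?D = "{p :: 'y \<Rightarrow> real. is_dist p}"
  let ?Q = "{q. is_dist q \<and> rel_ent q P \<le> ereal E}"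
  let ?h = "\<lambda>\<nu> q p. - \<nu> * \<Delta> + (\<Sum>x\<in>UNIV. q x * - ln (tilted d \<nu> p x))"
  have zero: "\<exists>y. d x y = 0" for x
  proof -
    have "Min (range (d x)) \<in> range (d x)" by (rule Min_in) auto
    moreover have "Min (range (d x)) \<le> Max (range (\<lambda>x. Min (range (d x))))" by (rule Max_ge) auto
    ultimately show ?thesis using d_max_min d_nonneg by (metis antisym imageE)
  qed
  have mix: "s \<le> t * a + (1 - t) * b \<Longrightarrow> c + s \<le> t * (c + a) + (1 - t) * (c + b)"
    for a b c s t :: real
    by (simp add: algebra_simps)
  have mix_uminus: "- (c + s) \<le> t * - (c + a) + (1 - t) * - (c + b)" if *: "s = t * a + (1 - t) * b"
    for a b c s t :: real
    unfolding * by (simp add: algebra_simps)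
  have D: "?D \<noteq> {}"
    using exI[of is_dist "\<lambda>_::'y. 1 / real CARD('y)"] by (simp add: is_dist_def)
  have Q_eq: "?Q = {q\<in>dists_on {x. P x \<noteq> 0}. kl q P \<le> E}"
    using rel_ent_le_iff[of _ P E] by (auto simp: dists_on_def)
  have "P \<in> dists_on {x. P x \<noteq> 0}" using P_dist by (simp add: dists_on_def)
  then have PQ: "P \<in> ?Q" using E_nonneg kl_self[of P] unfolding Q_eq by simp
  have "compact ?Q"
    unfolding Q_eq by (intro compact_sublevel compact_dists_on continuous_on_kl is_dist_nonneg[OF P_dist])

  let ?R = "{rate_dist d \<Delta> q | q. is_dist q \<and> rel_ent q P \<le> ereal E}"
  have "ereal (marton_inv d E \<Delta> P) = (SUP r\<in>?R. ereal r)"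
    unfolding marton_inv_def
  proof (rule ereal_Sup)
    have "(SUP r\<in>?R. ereal r) \<le> ereal (ln CARD('y))"
      using rate_dist_le_ln_card[OF _ zero Delta_nonneg] by (intro SUP_least) auto
    moreover have "ereal 0 \<le> (SUP r\<in>?R. ereal r)"
      using PQ rate_dist_nonneg[OF _ zero Delta_nonneg]
      by (intro SUP_upper2[of "rate_dist d \<Delta> P"]) auto
    ultimately show "\<bar>SUP r\<in>?R. ereal r\<bar> \<noteq> \<infinity>" by auto
  qed
  also have "?R = rate_dist d \<Delta> ` ?Q" by auto
  then have "(SUP r\<in>?R. ereal r) = (SUP q\<in>?Q. ereal (rate_dist d \<Delta> q))"
    by (simp add: image_comp)
  also have "\<dots> = (SUP q\<in>?Q. SUP \<nu>\<in>{0..}. INF p\<in>?D. ereal (?h \<nu> q p))"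
    using rate_dist_eq_SUP[OF _ zero Delta_nonneg] by (intro SUP_cong) auto
  also have "\<dots> = (SUP \<nu>\<in>{0..}. SUP q\<in>?Q. INF p\<in>?D. ereal (?h \<nu> q p))"
    by (rule SUP_commute)
  also have "\<dots> = (SUP \<nu>\<in>{0..}. INF \<mu>\<in>{0..}. ereal (- \<nu> * \<Delta> + \<mu> * E + G_min d \<mu> \<nu> P))"
  proof (intro SUP_cong refl)
    fix \<nu> :: real assume \<nu>: "\<nu> \<in> {0..}"
    have "(SUP q\<in>?Q. INF p\<in>?D. ereal (?h \<nu> q p)) = (INF p\<in>?D. SUP q\<in>?Q. ereal (?h \<nu> q p))"
    \<comment> \<open>The bracket is linear in \<open>q\<close> on the compact ball, and convex in
      \<open>p\<close> because \<open>tilted\<close> is linear in \<open>p\<close> and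
      \<open>- ln\<close> is convex.\<close>
    proof (rule fan_maximin)
      show "compact ?Q" by fact
      show "?D \<noteq> {}" by fact
      show "continuous_on ?Q (\<lambda>q. ?h \<nu> q p)" for p
        by (intro continuous_intros continuous_on_product_then_coordinatewise[OF continuous_on_id])
      show "convexlike_on ?Q ?D (\<lambda>q p. - ?h \<nu> q p)"
      proof (rule convexlike_onI[where g = "\<lambda>p q t x. t * p x + (1 - t) * q x"])
        fix q q' and t :: real
        assume *: "q \<in> ?Q" "q' \<in> ?Q" "0 \<le> t" "t \<le> 1"
        have "kl (\<lambda>x. t * q x + (1 - t) * q' x) P \<le> t * kl q P + (1 - t) * kl q' P"
          using * unfolding Q_eq by (intro kl_mix is_dist_nonneg[OF P_dist]) auto
        also have "\<dots> \<le> t * E + (1 - t) * E"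
          using * unfolding Q_eq by (intro add_mono mult_left_mono) auto
        finally show "(\<lambda>x. t * q x + (1 - t) * q' x) \<in> ?Q"
          using * dists_on_mix unfolding Q_eq by (auto simp: algebra_simps)
        fix p
        have "(\<Sum>x\<in>UNIV. (t * q x + (1 - t) * q' x) * - ln (tilted d \<nu> p x)) =
            t * (\<Sum>x\<in>UNIV. q x * - ln (tilted d \<nu> p x)) + (1 - t) * (\<Sum>x\<in>UNIV. q' x * - ln (tilted d \<nu> p x))"
          unfolding sum_distrib_left sum.distrib[symmetric]
          by (intro sum.cong) (auto simp: algebra_simps)
        then show "- ?h \<nu> (\<lambda>x. t * q x + (1 - t) * q' x) p \<le> t * - ?h \<nu> q p + (1 - t) * - ?h \<nu> q' p"
          by (rule mix_uminus)
      qed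
      show "convexlike_on ?D ?Q (\<lambda>p q. ?h \<nu> q p)"
      proof (rule convexlike_onI[where g = "\<lambda>p q t x. t * p x + (1 - t) * q x"])
        fix p p' :: "'y \<Rightarrow> real" and t :: real
        assume *: "p \<in> ?D" "p' \<in> ?D" "0 \<le> t" "t \<le> 1"
        then show "(\<lambda>y. t * p y + (1 - t) * p' y) \<in> ?D" using is_dist_mix by blast
        fix q assume "q \<in> ?Q"
        have ln: "- ln (tilted d \<nu> (\<lambda>y. t * p y + (1 - t) * p' y) x) \<le>
            t * - ln (tilted d \<nu> p x) + (1 - t) * - ln (tilted d \<nu> p' x)" for x
          using concave_onD[OF ln_concave, of "1 - t" "tilted d \<nu> p x" "tilted d \<nu> p' x"] *
          by (simp add: tilted_mix tilted_pos)
        have "(\<Sum>x\<in>UNIV. q x * - ln (tilted d \<nu> (\<lambda>y. t * p y + (1 - t) * p' y) x)) \<le>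
            (\<Sum>x\<in>UNIV. q x * (t * - ln (tilted d \<nu> p x) + (1 - t) * - ln (tilted d \<nu> p' x)))"
          using \<open>q \<in> ?Q\<close> ln by (intro sum_mono mult_left_mono) (auto simp: is_dist_nonneg)
        also have "\<dots> = t * (\<Sum>x\<in>UNIV. q x * - ln (tilted d \<nu> p x)) +
            (1 - t) * (\<Sum>x\<in>UNIV. q x * - ln (tilted d \<nu> p' x))"
          unfolding sum_distrib_left sum.distrib[symmetric]
          by (intro sum.cong) (auto simp: algebra_simps)
        finally show "?h \<nu> q (\<lambda>y. t * p y + (1 - t) * p' y) \<le> t * ?h \<nu> q p + (1 - t) * ?h \<nu> q p'"
          by (rule mix)
      qed
    qed
    \<comment> \<open>Duality over the ball is applied for each \<open>p\<close> separately, with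
      \<open>- ln (tilted d \<nu> p x)\<close> as \<open>f x\<close> and
      \<open>G_fun d \<mu> \<nu> p P\<close> as \<open>L \<mu>\<close>.\<close>
    also have "\<dots> = (INF p\<in>?D. INF \<mu>\<in>{0..}. ereal (- \<nu> * \<Delta> + \<mu> * E + G_fun d \<mu> \<nu> p P))"
      by (intro INF_cong refl SUP_rel_ent_ball_eq_INF P_dist E_nonneg) (simp_all add: G_fun_0_ge G_fun_pos)
    also have "\<dots> = (INF \<mu>\<in>{0..}. INF p\<in>?D. ereal (- \<nu> * \<Delta> + \<mu> * E + G_fun d \<mu> \<nu> p P))"
      by (rule INF_commute)
    also have "\<dots> = (INF \<mu>\<in>{0..}. ereal (- \<nu> * \<Delta> + \<mu> * E + G_min d \<mu> \<nu> P))"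
    proof (intro INF_cong refl)
      fix \<mu> :: real assume "\<mu> \<in> {0..}"
      then have "bdd_below ((\<lambda>p. G_fun d \<mu> \<nu> p P) ` ?D)"
        using G_fun_nonneg[OF P_dist _ d_nonneg] \<nu> by (intro bdd_belowI[of _ 0]) auto
      then show "(INF p\<in>?D. ereal (- \<nu> * \<Delta> + \<mu> * E + G_fun d \<mu> \<nu> p P)) =
          ereal (- \<nu> * \<Delta> + \<mu> * E + G_min d \<mu> \<nu> P)"
        unfolding G_min_def by (rule ereal_add_Inf_Collect[OF _ D, symmetric])
    qed
    finally show "(SUP q\<in>?Q. INF p\<in>?D. ereal (?h \<nu> q p)) =
        (INF \<mu>\<in>{0..}. ereal (- \<nu> * \<Delta> + \<mu> * E + G_min d \<mu> \<nu> P))" .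
  qed
  finally show ?thesis .
qed

end
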